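(* Let $G$ be a finite connected graph with vertex set $[n]$, with multiple edges allowed and no self-loops. Then the following equalities of ideals of $\mathbb{Q}[x_1,\dots,x_n]$ hold: $$\mathsf{T}_+(G)=\mathcal{I}_+(G),\qquad \mathsf{T}_-(G)=\mathcal{I}_-(G).$$
   Context: For a nonempty proper $S\subset[n]$, the edge cut $\partial(S)$ is the set of edges of $G$ with one endpoint in $S$ and the other outside, and $d(S)=|\partial(S)|$. A bond is an inclusion-minimal nonempty edge cut. Put $x_S=\sum_{i\in S}x_i$. Define $$\mathcal{I}_+(G)=\langle x_{[n]},\ x_S^{d(S)+1} : \partial(S)\text{ a bond}\rangle,\qquad \mathcal{I}_-(G)=\langle x_{[n]},\ x_S^{d(S)-1} : \partial(S)\text{ a bond}\rangle$$ (the ideals defining the external and internal zonotopal algebras). For an orientation $\mathcal{O}$ of the edges of $G$, the associated orientable divisor is $(\mathrm{indeg}_{\mathcal{O}}(1)-1,\dots,\mathrm{indeg}_{\mathcal{O}}(n)-1)\in\mathbb{Z}^n$, where $\mathrm{indeg}_{\mathcal{O}}(i)$ is the number of edges directed into $i$. $\mathrm{Orientable}(G)$ is the set of all orientable divisors of $G$. It is the set of lattice points of the polytope obtained by translating by $-(1,\dots,1)$ the graphical zonotope $\mathcal{Z}_G=\sum_{\{i,j\}\in E(G)}[e_i,e_j]$ (Minkowski sum of segments, with multiplicity); this polytope lies in the hyperplane $x_1+\cdots+x_n=|E(G)|-n$. $\mathrm{Orientable}^\circ(G)$ is the set of lattice points in the interior of this polytope (interior relative to its affine span). Orbit harmonics: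 for a finite $Y\subset\mathbb{Q}^n$ let $\mathsf{I}(Y)$ be the ideal of polynomials in $\mathbb{Q}[x_1,\dots,x_n]$ vanishing on $Y$, and $\mathsf{T}(Y)=\langle\tau(f): f\in\mathsf{I}(Y), f\ne0\rangle$, where $\tau(f)$ is the top-degree homogeneous component of $f$. Set $\mathsf{T}_+(G)=\mathsf{T}(\mathrm{Orientable}(G))$ and $\mathsf{T}_-(G)=\mathsf{T}(\mathrm{Orientable}^\circ(G))$. *)

theory Defs
  imports "HOL-Analysis.Analysis" "HOL-Library.Poly_Mapping" "HOL-Library.Set_Algebras"
begin

section \<open>Polynomials\<close>

text \<open>
  A polynomial in variables \<open>x\<^sub>i\<close>, with \<open>i\<close> in the finite index type \<open>'n\<close>, is a finitely
  supported map from exponent vectors to coefficients; \<open>'n mpoly\<close> is the ring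
  \<open>\<rat>[x\<^sub>i : i \<in> 'n]\<close>, with the convolution product of \<^theory>\<open>HOL-Library.Poly_Mapping\<close>.
\<close>

type_synonym 'n mpoly = "('n \<Rightarrow>\<^sub>0 nat) \<Rightarrow>\<^sub>0 rat"

definition var :: "'n \<Rightarrow> 'n mpoly" where
  "var i = Poly_Mapping.single (Poly_Mapping.single i 1) 1"

definition eval :: "rat ^ 'n \<Rightarrow> 'n::finite mpoly \<Rightarrow> rat" where
  "eval y f = (\<Sum>m\<in>Poly_Mapping.keys f.
     Poly_Mapping.lookup f m * (\<Prod>i\<in>UNIV. (y $ i) ^ Poly_Mapping.lookup m i))"

definition mon_degree :: "('n::finite \<Rightarrow>\<^sub>0 nat) \<Rightarrow> nat" where
  "mon_degree m = (\<Sum>i\<in>UNIV. Poly_Mapping.lookup m i)"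

definition total_degree :: "'n::finite mpoly \<Rightarrow> nat" where
  "total_degree f = Max (mon_degree ` Poly_Mapping.keys f)"

definition homogeneous_component :: "nat \<Rightarrow> 'n::finite mpoly \<Rightarrow> 'n mpoly" where
  "homogeneous_component d f =
     (\<Sum>m | m \<in> Poly_Mapping.keys f \<and> mon_degree m = d.
        Poly_Mapping.single m (Poly_Mapping.lookup f m))"

text \<open>Only meaningful for \<open>f \<noteq> 0\<close>, since \<^const>\<open>total_degree\<close> is unspecified at \<open>0\<close>.\<close>

definition top_component :: "'n::finite mpoly \<Rightarrow> 'n mpoly" where
  "top_component f = homogeneous_component (total_degree f) f"

text \<open>
  The ideal generated by a set is its span in the ring regarded as a module over itself,
  available as \<open>ideal.span\<close>.
\<close>

interpretation ideal: module "(*) :: 'a::comm_ring_1 \<Rightarrow> 'a \<Rightarrow> 'a"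
  by standard (simp_all add: algebra_simps)

section \<open>Orbit harmonics\<close>

definition vanishing_ideal :: "(rat ^ 'n::finite) set \<Rightarrow> 'n mpoly set" where
  "vanishing_ideal Y = {f. \<forall>y\<in>Y. eval y f = 0}"

definition top_ideal :: "(rat ^ 'n::finite) set \<Rightarrow> 'n mpoly set" where
  "top_ideal Y = ideal.span {top_component f | f. f \<in> vanishing_ideal Y \<and> f \<noteq> 0}"

section \<open>Multigraphs\<close>

text \<open>
  The vertex set is the whole (finite, nonempty) type \<open>'n\<close>. Edges are the elements of \<open>E\<close>, and
  \<open>ends e\<close> is the set of endpoints of \<open>e\<close>; parallel edges are distinct elements of \<open>E\<close> with the
  same endpoints.
\<close>

definition multigraph :: "'e set \<Rightarrow> ('e \<Rightarrow> 'n::finite set) \<Rightarrow> bool" where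
  "multigraph E ends \<longleftrightarrow> finite E \<and> (\<forall>e\<in>E. card (ends e) = 2)"

definition connected_graph :: "'e set \<Rightarrow> ('e \<Rightarrow> 'n::finite set) \<Rightarrow> bool" where
  "connected_graph E ends \<longleftrightarrow> (\<forall>u v. (u, v) \<in> {(a, b). \<exists>e\<in>E. ends e = {a, b}}\<^sup>*)"

definition boundary :: "'e set \<Rightarrow> ('e \<Rightarrow> 'n::finite set) \<Rightarrow> 'n set \<Rightarrow> 'e set" where
  "boundary E ends S = {e \<in> E. \<exists>u v. ends e = {u, v} \<and> u \<in> S \<and> v \<notin> S}"

definition edge_cut :: "'e set \<Rightarrow> ('e \<Rightarrow> 'n::finite set) \<Rightarrow> 'e set \<Rightarrow> bool" where
  "edge_cut E ends C \<longleftrightarrow> (\<exists>S. S \<noteq> {} \<and> S \<noteq> UNIV \<and> C = boundary E ends S)"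

definition bond :: "'e set \<Rightarrow> ('e \<Rightarrow> 'n::finite set) \<Rightarrow> 'e set \<Rightarrow> bool" where
  "bond E ends C \<longleftrightarrow> edge_cut E ends C \<and> C \<noteq> {} \<and>
     (\<forall>C'. edge_cut E ends C' \<and> C' \<noteq> {} \<and> C' \<subseteq> C \<longrightarrow> C' = C)"

section \<open>External and internal ideals\<close>

definition var_sum :: "'n::finite set \<Rightarrow> 'n mpoly" where
  "var_sum S = (\<Sum>i\<in>S. var i)"

definition external_ideal :: "'e set \<Rightarrow> ('e \<Rightarrow> 'n::finite set) \<Rightarrow> 'n mpoly set" where
  "external_ideal E ends = ideal.span (insert (var_sum UNIV)
     {var_sum S ^ (card (boundary E ends S) + 1) | S.
        S \<noteq> {} \<and> S \<noteq> UNIV \<and> bond E ends (boundary E ends S)})"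

text \<open>The subtraction does not truncate: a bond is nonempty.\<close>

definition internal_ideal :: "'e set \<Rightarrow> ('e \<Rightarrow> 'n::finite set) \<Rightarrow> 'n mpoly set" where
  "internal_ideal E ends = ideal.span (insert (var_sum UNIV)
     {var_sum S ^ (card (boundary E ends S) - 1) | S.
        S \<noteq> {} \<and> S \<noteq> UNIV \<and> bond E ends (boundary E ends S)})"

section \<open>Orientable divisors\<close>

text \<open>
  An orientation is given by the head \<open>h e \<in> ends e\<close> of each edge; there being no loops, the
  head determines the direction of the edge.
\<close>

definition orientation :: "'e set \<Rightarrow> ('e \<Rightarrow> 'n::finite set) \<Rightarrow> ('e \<Rightarrow> 'n) \<Rightarrow> bool" where
  "orientation E ends h \<longleftrightarrow> (\<forall>e\<in>E. h e \<in> ends e)"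

definition indeg :: "'e set \<Rightarrow> ('e \<Rightarrow> 'n::finite) \<Rightarrow> 'n \<Rightarrow> nat" where
  "indeg E h i = card {e \<in> E. h e = i}"

definition orientable :: "'e set \<Rightarrow> ('e \<Rightarrow> 'n::finite set) \<Rightarrow> (int ^ 'n) set" where
  "orientable E ends = {\<chi> i. int (indeg E h i) - 1 | h. orientation E ends h}"

text \<open>
  The sum is the Minkowski sum of \<^theory>\<open>HOL-Library.Set_Algebras\<close>. For \<open>ends e = {i, j}\<close> the
  summand is the convex hull of the two unit vectors \<open>e\<^sub>i\<close>, \<open>e\<^sub>j\<close>, that is, the segment between them.
\<close>

definition zonotope :: "'e set \<Rightarrow> ('e \<Rightarrow> 'n::finite set) \<Rightarrow> (real ^ 'n) set" where
  "zonotope E ends = (\<Sum>e\<in>E. convex hull ((\<lambda>i. axis i 1) ` ends e))"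

definition of_int_vec :: "int ^ 'n::finite \<Rightarrow> 'a::ring_1 ^ 'n" where
  "of_int_vec z = (\<chi> i. of_int (z $ i))"

definition orientable_interior :: "'e set \<Rightarrow> ('e \<Rightarrow> 'n::finite set) \<Rightarrow> (int ^ 'n) set" where
  "orientable_interior E ends =
     {z. of_int_vec z \<in> rel_interior ((\<lambda>x. x - (\<chi> i. 1)) ` zonotope E ends)}"

definition T_plus :: "'e set \<Rightarrow> ('e \<Rightarrow> 'n::finite set) \<Rightarrow> 'n mpoly set" where
  "T_plus E ends = top_ideal (of_int_vec ` orientable E ends)"

definition T_minus :: "'e set \<Rightarrow> ('e \<Rightarrow> 'n::finite set) \<Rightarrow> 'n mpoly set" where
  "T_minus E ends = top_ideal (of_int_vec ` orientable_interior E ends)"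

end

theory Submission
  imports Defs
begin

text \<open>
  One inclusion of each equality is elementary. On the (interior) orientable divisors the form \<open>x\<^sub>S\<close>
  takes at most \<open>d(S) + 1\<close> (respectively \<open>d(S) - 1\<close>) values, one for each possible number of edges of
  the cut that point into \<open>S\<close>, where the interior excludes the two extreme numbers. The product of the corresponding affine factors vanishes on the points
  and has the power of \<open>x\<^sub>S\<close> as its leading form (\<open>vanishing_product\<close>).

  The other inclusion, that leading forms of vanishing polynomials lie in the power ideal, is an
  induction over deletion and contraction of an edge \<open>e\<close> with ends \<open>a\<close>, \<open>b\<close>, carried out directly on
  polynomials and without counting dimensions (\<open>deletion_contraction\<close>). Put \<open>v = e\<^sub>a - e\<^sub>b\<close>. If \<open>f\<close>
  vanishes on the points of \<open>G\<close>, then \<open>f(x + v) - f(x)\<close> vanishes on a translate of the points of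
  \<open>G - e\<close>, since \<open>e\<close> can be directed both ways. Its leading form is the derivative along \<open>v\<close> of a
  homogeneous component of \<open>f\<close>, and by induction it lies in the ideal of \<open>G - e\<close>. Integration by parts
  shows that every element of that ideal is the derivative of an element of the ideal of \<open>G\<close>, because
  deleting \<open>e\<close> lowers by one exactly the exponents of the forms \<open>x\<^sub>S\<close> that are not constant along \<open>v\<close>
  (\<open>deletion_integral\<close>). Subtracting vanishing polynomials with these leading forms reduces to the case
  that \<open>f\<close> is invariant under \<open>v\<close>. Such an \<open>f\<close> is a polynomial on the contraction \<open>G / e\<close>, vanishes
  on its points, and is covered by the induction hypothesis.

  The induction for the internal ideal runs over strongly connected orientations. A strongly connected
  orientation of \<open>G / e\<close> lifts to \<open>G\<close> unless \<open>e\<close> is a bridge (\<open>strong_lift\<close>), and a bridge makes the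
  power ideal the unit ideal. The indegree vectors of strongly connected orientations are interior
  points by a supporting hyperplane argument (\<open>strong_in_rel_interior\<close>), while the interior points have
  the required few values (\<open>few_values_orientable_interior\<close>). Together with the induction these two
  facts give both inclusions for the interior points.

  The induction yields the ideal of the powers for all vertex sets \<open>S\<close>. Restricting to bonds does not
  change it, since a cut that is not a bond splits into two disjoint smaller cuts
  (\<open>cut_powers_in_ideal\<close>).
\<close>

section \<open>Substitution homomorphisms and the monomial induction principle\<close>

text \<open>
  As a simplification rule the module law \<open>a * (b * x) = (a * b) * x\<close> loops together with the
  associative-commutative rewriting of products.
\<close>

declare ideal.scale_scale [simp del]

abbreviation const :: "rat \<Rightarrow> 'n mpoly" where
  "const \<equiv> Poly_Mapping.single 0"

lemma const_add: "const (a + b) = const a + const b"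
  by (simp add: single_add)

lemma const_mult: "const (a * b) = (const a * const b :: 'n mpoly)"
  by (simp add: mult_single)

lemma const_mult_cancel: "a \<noteq> 0 \<Longrightarrow> const (1 / a) * (const a * f) = (f :: 'n mpoly)"
  by (simp add: mult.assoc[symmetric] mult_single)

lemma single_conv_sum:
  "f = (\<Sum>m\<in>Poly_Mapping.keys f. Poly_Mapping.single m (Poly_Mapping.lookup f m))"
proof (rule poly_mapping_eqI)
  fix k
  show "Poly_Mapping.lookup f k = Poly_Mapping.lookup
      (\<Sum>m\<in>Poly_Mapping.keys f. Poly_Mapping.single m (Poly_Mapping.lookup f m)) k"
    by (auto simp: lookup_sum lookup_single when_def in_keys_iff sum.delta')
qed

lemma mon_degree_add: "mon_degree (a + b) = mon_degree a + mon_degree b"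
  by (simp add: mon_degree_def lookup_add sum.distrib)

lemma mon_degree_zero [simp]: "mon_degree 0 = 0"
  by (simp add: mon_degree_def)

lemma mon_degree_unit [simp]: "mon_degree (Poly_Mapping.single i (Suc 0)) = 1"
  by (simp add: mon_degree_def lookup_single when_def)

lemma exponent_induct [case_names zero add]:
  fixes m :: "'n::finite \<Rightarrow>\<^sub>0 nat"
  assumes "P 0" and "\<And>m j. P m \<Longrightarrow> P (m + Poly_Mapping.single j 1)"
  shows "P m"
proof (induction "mon_degree m" arbitrary: m)
  case 0
  then have "m = 0"
    by (intro poly_mapping_eqI) (simp add: mon_degree_def)
  then show ?case using assms(1) by simp
next
  case (Suc d)
  then obtain j where j: "Poly_Mapping.lookup m j > 0"
    by (metis mon_degree_def neq0_conv sum.neutral zero_less_Suc)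
  have m: "m = (m - Poly_Mapping.single j 1) + Poly_Mapping.single j 1"
    using j by (intro poly_mapping_eqI) (auto simp: lookup_add lookup_minus lookup_single when_def)
  have "d = mon_degree (m - Poly_Mapping.single j 1)"
    using Suc(2) arg_cong[OF m, of mon_degree] by (simp add: mon_degree_add)
  from Suc(1)[OF this] assms(2) m show ?case by metis
qed

lemma mpoly_additive_induct [case_names zero add single]:
  fixes f :: "'n mpoly"
  assumes "P 0" and "\<And>f g. P f \<Longrightarrow> P g \<Longrightarrow> P (f + g)"
    and "\<And>m c. P (Poly_Mapping.single m c)"
  shows "P f"
proof -
  have "P (\<Sum>m\<in>A. Poly_Mapping.single m (Poly_Mapping.lookup f m))" if "finite A" for A
    using that by (induction A rule: finite_induct) (auto intro: assms)
  from this[OF finite_keys[of f]] show ?thesis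
    by (subst single_conv_sum)
qed

text \<open>
  Multiplying by one variable at a time keeps the inductive step of identities for homomorphisms
  and derivations to a single application of the product rule.
\<close>

lemma mpoly_induct [case_names const add var]:
  fixes f :: "'n::finite mpoly"
  assumes "\<And>c. P (const c)" and add: "\<And>f g. P f \<Longrightarrow> P g \<Longrightarrow> P (f + g)"
    and "\<And>f j. P f \<Longrightarrow> P (f * var j)"
  shows "P f"
proof (induction f rule: mpoly_additive_induct)
  case zero
  show ?case using assms(1)[of 0] by simp
next
  case (single m c)
  show ?case
  proof (induction m rule: exponent_induct)
    case (add m j)
    from assms(3)[OF add, of j] show ?case by (simp add: var_def mult_single)
  qed (rule assms)
qed (rule add)

definition insertion :: "(rat \<Rightarrow> 'a) \<Rightarrow> ('n \<Rightarrow> 'a) \<Rightarrow> 'n::finite mpoly \<Rightarrow> 'a::comm_ring_1" where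
  "insertion c v f = (\<Sum>m\<in>Poly_Mapping.keys f.
     c (Poly_Mapping.lookup f m) * (\<Prod>i\<in>UNIV. v i ^ Poly_Mapping.lookup m i))"

locale insertion_hom =
  fixes c :: "rat \<Rightarrow> 'a::comm_ring_1" and v :: "'n::finite \<Rightarrow> 'a"
  assumes c_zero: "c 0 = 0" and c_one: "c 1 = 1"
    and c_add: "\<And>a b. c (a + b) = c a + c b"
    and c_mult: "\<And>a b. c (a * b) = c a * c b"
begin

lemma superset:
  assumes "finite A" "Poly_Mapping.keys f \<subseteq> A"
  shows "insertion c v f = (\<Sum>m\<in>A.
     c (Poly_Mapping.lookup f m) * (\<Prod>i\<in>UNIV. v i ^ Poly_Mapping.lookup m i))"
  unfolding insertion_def using assms
  by (intro sum.mono_neutral_left) (auto simp: in_keys_iff c_zero)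

lemma hom_add: "insertion c v (f + g) = insertion c v f + insertion c v g"
proof -
  let ?A = "Poly_Mapping.keys f \<union> Poly_Mapping.keys g"
  have "Poly_Mapping.keys (f + g) \<subseteq> ?A" by (rule keys_add)
  then show ?thesis
    by (simp add: superset[of ?A] lookup_add c_add distrib_right sum.distrib)
qed

lemma hom_single:
  "insertion c v (Poly_Mapping.single m a) = c a * (\<Prod>i\<in>UNIV. v i ^ Poly_Mapping.lookup m i)"
  by (subst superset[of "{m}"]) (auto simp: c_zero)

lemma hom_const: "insertion c v (const a) = c a"
  by (simp add: hom_single)

lemma hom_zero: "insertion c v 0 = 0"
  using hom_const[of 0] by (simp add: c_zero)

lemma hom_mult_const: "insertion c v (f * const a) = insertion c v f * c a"
proof (induction f rule: mpoly_additive_induct)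
  case (single m b)
  have "insertion c v (Poly_Mapping.single m b * const a) =
      c b * c a * (\<Prod>i\<in>UNIV. v i ^ Poly_Mapping.lookup m i)"
    by (simp only: mult_single add_0_right hom_single c_mult)
  then show ?case by (simp only: hom_single mult_ac)
next
  case (add f g)
  then show ?case by (simp only: hom_add distrib_right)
qed (simp only: hom_zero mult_zero_left)

lemma prod_unit:
  "(\<Prod>i\<in>UNIV. v i ^ Poly_Mapping.lookup (Poly_Mapping.single j (Suc 0)) i) = v j"
proof -
  have "(\<Prod>i\<in>UNIV. v i ^ Poly_Mapping.lookup (Poly_Mapping.single j (Suc 0)) i) =
      (\<Prod>i\<in>UNIV. if i = j then v i else 1)"
    by (intro prod.cong) (auto simp: lookup_single when_def)
  then show ?thesis by simp
qed

lemma hom_mult_var: "insertion c v (f * var j) = insertion c v f * v j"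
proof (induction f rule: mpoly_additive_induct)
  case (single m b)
  have "Poly_Mapping.single m b * var j = Poly_Mapping.single (m + Poly_Mapping.single j (Suc 0)) b"
    by (simp add: var_def mult_single)
  then show ?case
    by (simp only: hom_single lookup_add power_add prod.distrib prod_unit mult.assoc)
qed (simp_all add: hom_zero hom_add distrib_right)

lemma hom_var: "insertion c v (var j) = v j"
  using hom_mult_var[of 1 j] hom_const[of 1] by (simp add: c_one)

lemma hom_mult: "insertion c v (f * g) = insertion c v f * insertion c v g"
proof (induction g rule: mpoly_induct)
  case (var g j)
  then show ?case
    by (simp only: mult.assoc[symmetric] hom_mult_var)
qed (simp_all add: hom_mult_const hom_const distrib_left hom_add)

end

lemma insertion_hom_eval: "insertion_hom (\<lambda>a. a :: rat)"
  by standard simp_all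

lemma eval_conv_insertion: "eval y f = insertion (\<lambda>a. a) (\<lambda>i. y $ i) f"
  by (simp add: eval_def insertion_def)

lemma eval_add: "eval y (f + g) = eval y f + eval y g"
  and eval_mult: "eval y (f * g) = eval y f * eval y g"
  and eval_const [simp]: "eval y (const a) = a"
  and eval_var [simp]: "eval y (var j) = y $ j"
  and eval_zero [simp]: "eval y 0 = 0"
  by (simp_all only: eval_conv_insertion insertion_hom.hom_add[OF insertion_hom_eval]
    insertion_hom.hom_mult[OF insertion_hom_eval] insertion_hom.hom_const[OF insertion_hom_eval]
    insertion_hom.hom_var[OF insertion_hom_eval] insertion_hom.hom_zero[OF insertion_hom_eval])

lemma eval_one [simp]: "eval y 1 = 1"
  using eval_const[of y 1] by simp

lemma eval_minus: "eval y (- f) = - eval y f"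
  using eval_add[of y f "- f"] by simp

lemma eval_diff: "eval y (f - g) = eval y f - eval y g"
  using eval_add[of y f "- g"] by (simp add: eval_minus)

lemma eval_sum: "eval y (sum f A) = (\<Sum>a\<in>A. eval y (f a))"
  by (induction A rule: infinite_finite_induct) (simp_all add: eval_add)

lemma eval_prod: "eval y (prod f A) = (\<Prod>a\<in>A. eval y (f a))"
  by (induction A rule: infinite_finite_induct) (simp_all add: eval_mult)

lemma eval_var_sum: "eval y (var_sum S) = (\<Sum>i\<in>S. y $ i)"
  by (simp add: var_sum_def eval_sum)

section \<open>Directional derivatives and translations\<close>

text \<open>
  \<open>line v f\<close> is \<open>f(x + t v)\<close> as a polynomial in \<open>t\<close>. Its linear coefficient is the
  derivative of \<open>f\<close> along \<open>v\<close> and its value at \<open>t = 1\<close> is the translate of \<open>f\<close>, so that one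
  homomorphism provides both operators and the Taylor formula that relates them.
\<close>

definition line :: "rat ^ 'n \<Rightarrow> 'n::finite mpoly \<Rightarrow> 'n mpoly poly" where
  "line v = insertion (\<lambda>a. [:const a:]) (\<lambda>i. [:var i, const (v $ i):])"

lemma insertion_hom_line: "insertion_hom (\<lambda>a. [:const a:] :: 'n mpoly poly)"
  by standard (simp_all add: single_add mult_single one_pCons mult.commute)

lemma line_add: "line v (f + g) = line v f + line v g"
  and line_mult: "line v (f * g) = line v f * line v g"
  and line_const: "line v (const a) = [:const a:]"
  and line_var: "line v (var j) = [:var j, const (v $ j):]"
  and line_zero: "line v 0 = 0"
  by (simp_all only: line_def insertion_hom.hom_add[OF insertion_hom_line]
    insertion_hom.hom_mult[OF insertion_hom_line] insertion_hom.hom_const[OF insertion_hom_line]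
    insertion_hom.hom_var[OF insertion_hom_line] insertion_hom.hom_zero[OF insertion_hom_line])

lemma coeff_line_0: "coeff (line v f) 0 = f"
  by (induction f rule: mpoly_induct)
    (simp_all add: line_const line_add line_mult line_var coeff_mult)

definition deriv_along :: "rat ^ 'n \<Rightarrow> 'n::finite mpoly \<Rightarrow> 'n mpoly" where
  "deriv_along v f = coeff (line v f) 1"

lemma deriv_add: "deriv_along v (f + g) = deriv_along v f + deriv_along v g"
  by (simp add: deriv_along_def line_add)

lemma deriv_mult: "deriv_along v (f * g) = deriv_along v f * g + f * deriv_along v g"
  by (simp add: deriv_along_def line_mult coeff_mult coeff_line_0 algebra_simps)

lemma deriv_const [simp]: "deriv_along v (const a) = 0"
  by (simp add: deriv_along_def line_const)

lemma deriv_zero [simp]: "deriv_along v 0 = 0"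
  using deriv_const[of v 0] by (simp del: deriv_const)

lemma deriv_one [simp]: "deriv_along v 1 = 0"
  using deriv_const[of v 1] by (simp del: deriv_const)

lemma deriv_var [simp]: "deriv_along v (var j) = const (v $ j)"
  by (simp add: deriv_along_def line_var)

lemma deriv_minus: "deriv_along v (- f) = - deriv_along v f"
  using deriv_add[of v f "- f"] by (simp add: eq_neg_iff_add_eq_0 add.commute)

lemma deriv_diff: "deriv_along v (f - g) = deriv_along v f - deriv_along v g"
  using deriv_add[of v f "- g"] by (simp add: deriv_minus)

lemma deriv_sum: "deriv_along v (sum f A) = (\<Sum>a\<in>A. deriv_along v (f a))"
  by (induction A rule: infinite_finite_induct) (simp_all add: deriv_add)

lemma deriv_power:
  "deriv_along v (f ^ Suc k) = const (of_nat (Suc k)) * (f ^ k * deriv_along v f)"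
proof (induction k)
  case (Suc k)
  have "deriv_along v (f ^ Suc (Suc k)) = deriv_along v f * f ^ Suc k + f * deriv_along v (f ^ Suc k)"
    by (simp only: power_Suc[of f "Suc k"] deriv_mult)
  also have "\<dots> = const (of_nat (Suc k) + 1) * (f ^ Suc k * deriv_along v f)"
    by (simp only: Suc const_add distrib_right single_one) (simp add: algebra_simps)
  finally show ?case by (simp add: add.commute)
qed simp

lemma deriv_var_sum: "deriv_along v (var_sum S) = const (\<Sum>i\<in>S. v $ i)"
  unfolding var_sum_def
  by (induction S rule: infinite_finite_induct) (simp_all add: deriv_add const_add)

lemma deriv_commute:
  "deriv_along v (deriv_along w f) = deriv_along w (deriv_along v f)"
proof (induction f rule: mpoly_induct)
  case (var f j)
  then show ?case by (simp add: deriv_add deriv_mult)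
qed (simp_all add: deriv_add)

text \<open>Comparing coefficients of \<open>t\<close> in \<open>d/dt f(x + t v) = (D\<^sub>v f)(x + t v)\<close>.\<close>

lemma coeff_line_Suc:
  "const (of_nat (Suc k)) * coeff (line v f) (Suc k) = coeff (line v (deriv_along v f)) k"
proof (induction f arbitrary: k rule: mpoly_induct)
  case (var f j)
  let ?A = "coeff (line v f)" and ?B = "coeff (line v (deriv_along v f))"
  have A: "coeff (line v f * [:var j, const (v $ j):]) (Suc k) = ?A (Suc k) * var j + ?A k * const (v $ j)"
    for k by (simp add: algebra_simps)
  show ?case
  proof (cases k)
    case 0
    with var[of 0] show ?thesis
      by (simp add: line_mult line_var deriv_mult line_add line_const coeff_line_0 algebra_simps)
  next
    case (Suc l)
    have "const (of_nat (Suc k)) * coeff (line v (f * var j)) (Suc k) =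
        const (of_nat (Suc k)) * ?A (Suc k) * var j + const (of_nat (Suc k)) * ?A k * const (v $ j)"
      by (simp add: line_mult line_var A distrib_left mult.assoc del: of_nat_Suc mult_pCons_right)
    also have "const (of_nat (Suc k)) * ?A k = const (of_nat (Suc l)) * ?A (Suc l) + ?A k"
      by (simp add: Suc const_add distrib_right)
    also have "const (of_nat (Suc k)) * ?A (Suc k) = ?B k" by (rule var)
    also have "const (of_nat (Suc l)) * ?A (Suc l) = ?B l" by (rule var)
    also have "?B k * var j + (?B l + ?A k) * const (v $ j) =
        coeff (line v (deriv_along v (f * var j))) k"
      by (simp add: Suc line_mult line_var A deriv_mult line_add line_const algebra_simps
          del: mult_pCons_right) (simp add: algebra_simps)
    finally show ?thesis .
  qed
qed (simp_all add: line_const line_add line_zero deriv_add distrib_left)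

lemma coeff_line_Suc_eq:
  "coeff (line v f) (Suc k) = const (1 / of_nat (Suc k)) * coeff (line v (deriv_along v f)) k"
  unfolding coeff_line_Suc[symmetric] by (rule const_mult_cancel[symmetric]) simp

definition difference :: "rat ^ 'n \<Rightarrow> 'n::finite mpoly \<Rightarrow> 'n mpoly" where
  "difference v f = poly (line v f) 1 - f"

lemma eval_difference: "eval y (difference v f) = eval (y + v) f - eval y f"
proof -
  have "eval y (poly (line v f) 1) = eval (y + v) f"
    by (induction f rule: mpoly_induct)
      (simp_all add: line_const line_add line_mult line_var eval_add eval_mult algebra_simps)
  then show ?thesis by (simp add: difference_def eval_diff)
qed

lemma difference_diff: "difference v (f - g) = difference v f - difference v g"
proof -
  have "line v f = line v (f - g) + line v g"
    by (simp add: line_add[symmetric])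
  then show ?thesis by (simp add: difference_def)
qed

lemma poly_at_1: "poly (p :: 'a::comm_ring_1 poly) 1 = (\<Sum>k\<le>Polynomial.degree p. coeff p k)"
  by (simp add: poly_altdef)

text \<open>Taylor's formula, with any upper bound for the order of the last term.\<close>

lemma difference_conv_sum:
  assumes "\<And>k. N < k \<Longrightarrow> coeff (line v f) k = 0"
  shows "difference v f = (\<Sum>k\<in>{1..N}. coeff (line v f) k)"
proof -
  have "poly (line v f) 1 = (\<Sum>k\<le>N. coeff (line v f) k)"
    unfolding poly_at_1 using assms
    by (intro sum.mono_neutral_left) (auto intro: degree_le simp: coeff_eq_0)
  also have "{..N} = insert 0 {1..N}" by auto
  also have "(\<Sum>k\<in>insert 0 {1..N}. coeff (line v f) k) = f + (\<Sum>k\<in>{1..N}. coeff (line v f) k)"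
    by (subst sum.insert) (simp_all add: coeff_line_0)
  finally show ?thesis by (simp add: difference_def)
qed

lemma coeff_line_of_constant:
  assumes "deriv_along v f = 0"
  shows "coeff (line v f) (Suc k) = 0"
  by (simp add: coeff_line_Suc_eq assms line_zero)

lemma deriv_coeff_line_zero:
  "deriv_along w f = 0 \<Longrightarrow> deriv_along w (coeff (line v f) k) = 0"
proof (induction k arbitrary: f)
  case (Suc k)
  from Suc.prems have "deriv_along w (deriv_along v f) = 0" by (simp add: deriv_commute[of w])
  from Suc.IH[OF this] show ?case by (simp add: coeff_line_Suc_eq deriv_mult)
qed (simp add: coeff_line_0)

lemma deriv_difference_zero:
  "deriv_along w f = 0 \<Longrightarrow> deriv_along w (difference v f) = 0"
  by (subst difference_conv_sum[OF coeff_eq_0]) (simp_all add: deriv_sum deriv_coeff_line_zero)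

section \<open>The grading\<close>

abbreviation hc :: "nat \<Rightarrow> 'n::finite mpoly \<Rightarrow> 'n mpoly" where
  "hc \<equiv> homogeneous_component"

definition deg_le :: "nat \<Rightarrow> 'n::finite mpoly \<Rightarrow> bool" where
  "deg_le d f \<longleftrightarrow> (\<forall>m\<in>Poly_Mapping.keys f. mon_degree m \<le> d)"

lemma lookup_hc:
  "Poly_Mapping.lookup (hc d f) m = (if mon_degree m = d then Poly_Mapping.lookup f m else 0)"
  by (auto simp: homogeneous_component_def lookup_sum lookup_single when_def in_keys_iff sum.delta')

lemma deg_le_iff_lookup:
  "deg_le d f \<longleftrightarrow> (\<forall>m. mon_degree m > d \<longrightarrow> Poly_Mapping.lookup f m = 0)"
  by (auto simp: deg_le_def in_keys_iff not_less[symmetric])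

lemma hc_add: "hc d (f + g) = hc d f + hc d g"
  and hc_diff: "hc d (f - g) = hc d f - hc d g"
  and hc_zero [simp]: "hc d 0 = 0"
  by (auto intro!: poly_mapping_eqI simp: lookup_hc lookup_add lookup_minus)

lemma hc_sum: "hc d (sum f A) = (\<Sum>a\<in>A. hc d (f a))"
  by (induction A rule: infinite_finite_induct) (simp_all add: hc_add)

lemma hc_hc: "hc d (hc e f) = (if d = e then hc d f else 0)"
  by (auto intro!: poly_mapping_eqI simp: lookup_hc)

lemma hc_single:
  "hc d (Poly_Mapping.single m c) = (if mon_degree m = d then Poly_Mapping.single m c else 0)"
  by (auto intro!: poly_mapping_eqI simp: lookup_hc lookup_single when_def)

lemma deg_le_hc: "deg_le d (hc d f)"
  by (simp add: deg_le_iff_lookup lookup_hc)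

lemma deg_le_add: "deg_le d f \<Longrightarrow> deg_le d g \<Longrightarrow> deg_le d (f + g)"
  and deg_le_diff: "deg_le d f \<Longrightarrow> deg_le d g \<Longrightarrow> deg_le d (f - g)"
  and deg_le_zero [simp]: "deg_le d 0"
  by (auto simp: deg_le_iff_lookup lookup_add lookup_minus)

lemma deg_le_sum: "(\<And>a. a \<in> A \<Longrightarrow> deg_le d (f a)) \<Longrightarrow> deg_le d (sum f A)"
  by (induction A rule: infinite_finite_induct) (auto intro: deg_le_add)

lemma deg_le_mono: "deg_le d f \<Longrightarrow> d \<le> e \<Longrightarrow> deg_le e f"
  by (auto simp: deg_le_def)

lemma hc_eq_zero: "deg_le d f \<Longrightarrow> d < e \<Longrightarrow> hc e f = 0"
  by (auto intro!: poly_mapping_eqI simp: lookup_hc deg_le_iff_lookup)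

lemma deg_le_const [simp]: "deg_le d (const a)"
  by (auto simp: deg_le_def split: if_splits)

lemma deg_le_one [simp]: "deg_le d 1"
  using deg_le_const[of d 1] by (simp del: deg_le_const)

lemma deg_le_mult: "deg_le d f \<Longrightarrow> deg_le e g \<Longrightarrow> deg_le (d + e) (f * g)"
  using keys_mult[of f g] by (fastforce simp: deg_le_def mon_degree_add intro: add_mono)

lemma deg_le_power: "deg_le d f \<Longrightarrow> deg_le (k * d) (f ^ k)"
  by (induction k) (auto intro: deg_le_mult)

lemma deg_le_var: "deg_le 1 (var i)"
  by (simp add: deg_le_def var_def)

lemma deg_le_var_sum: "deg_le 1 (var_sum S)"
  unfolding var_sum_def by (intro deg_le_sum deg_le_var)

lemma deg_le_lower:
  assumes "deg_le (Suc d) f" "hc (Suc d) f = 0"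
  shows "deg_le d f"
  unfolding deg_le_iff_lookup
proof (intro allI impI)
  fix m :: "'a \<Rightarrow>\<^sub>0 nat" assume "mon_degree m > d"
  moreover have "Poly_Mapping.lookup (hc (Suc d) f) m = 0" using assms(2) by simp
  ultimately show "Poly_Mapping.lookup f m = 0"
    using assms(1) by (cases "mon_degree m = Suc d") (auto simp: lookup_hc deg_le_iff_lookup)
qed

lemma hc_0_conv: "hc 0 f = const (Poly_Mapping.lookup f 0)"
proof (rule poly_mapping_eqI)
  fix m :: "'a \<Rightarrow>\<^sub>0 nat"
  have "mon_degree m = 0 \<longleftrightarrow> m = 0"
    by (auto simp: mon_degree_def intro: poly_mapping_eqI)
  then show "Poly_Mapping.lookup (hc 0 f) m = Poly_Mapping.lookup (const (Poly_Mapping.lookup f 0)) m"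
    by (auto simp: lookup_hc lookup_single when_def)
qed

lemma deg_le_0_conv: "deg_le 0 f \<Longrightarrow> f = const (Poly_Mapping.lookup f 0)"
  unfolding hc_0_conv[symmetric]
  by (rule poly_mapping_eqI) (auto simp: lookup_hc deg_le_iff_lookup)

lemma keys_hc: "Poly_Mapping.keys (hc d f) = {m \<in> Poly_Mapping.keys f. mon_degree m = d}"
  by (auto simp: in_keys_iff lookup_hc split: if_splits)

lemma hc_eq_zeroI: "(\<And>m. m \<in> Poly_Mapping.keys f \<Longrightarrow> mon_degree m \<noteq> d) \<Longrightarrow> hc d f = 0"
  by (intro poly_mapping_eqI) (auto simp: lookup_hc in_keys_iff)

lemma hc_eq_selfI: "(\<And>m. m \<in> Poly_Mapping.keys f \<Longrightarrow> mon_degree m = d) \<Longrightarrow> hc d f = f"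
  by (intro poly_mapping_eqI) (auto simp: lookup_hc in_keys_iff)

lemma keys_diff_hc: "m \<in> Poly_Mapping.keys (f - hc d f) \<Longrightarrow> m \<in> Poly_Mapping.keys f \<and> mon_degree m \<noteq> d"
  by (auto simp: in_keys_iff lookup_minus lookup_hc split: if_splits)

lemma keys_multE:
  assumes "m \<in> Poly_Mapping.keys (f * g)"
  obtains a b where "a \<in> Poly_Mapping.keys f" "b \<in> Poly_Mapping.keys g" "m = a + b"
  using keys_mult[of f g] assms by blast

lemma hc_mult_hc:
  "hc d (f * hc e g) = (if e \<le> d then hc (d - e) f * hc e g else 0)"
proof (cases "e \<le> d")
  case True
  have "hc d ((f - hc (d - e) f) * hc e g) = 0"
    using True by (intro hc_eq_zeroI) (auto elim!: keys_multE dest!: keys_diff_hc simp: keys_hc mon_degree_add)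
  moreover have "hc d (hc (d - e) f * hc e g) = hc (d - e) f * hc e g"
    using True by (intro hc_eq_selfI) (auto elim!: keys_multE simp: keys_hc mon_degree_add)
  ultimately show ?thesis using True by (simp add: left_diff_distrib hc_diff)
next
  case False
  have "hc d (f * hc e g) = 0"
    using False by (intro hc_eq_zeroI) (auto elim!: keys_multE simp: keys_hc mon_degree_add)
  then show ?thesis using False by simp
qed

lemma hc_mult_top:
  assumes "deg_le d f" "deg_le e g"
  shows "hc (d + e) (f * g) = hc d f * hc e g"
proof -
  have "hc (d + e) (f * (g - hc e g)) = 0"
  proof (rule hc_eq_zeroI)
    fix m assume "m \<in> Poly_Mapping.keys (f * (g - hc e g))"
    then obtain a b where ab: "a \<in> Poly_Mapping.keys f" "b \<in> Poly_Mapping.keys (g - hc e g)" "m = a + b"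
      by (rule keys_multE)
    then have "mon_degree a \<le> d" "mon_degree b < e"
      using assms keys_diff_hc[of b g e] by (auto simp: deg_le_def le_neq_implies_less)
    then show "mon_degree m \<noteq> d + e" by (simp add: ab(3) mon_degree_add)
  qed
  then have "hc (d + e) (f * g) = hc (d + e) (f * hc e g)"
    by (simp add: right_diff_distrib hc_diff)
  then show ?thesis by (simp add: hc_mult_hc)
qed

lemma hc_var: "hc 1 (var i) = var i"
  by (simp add: var_def hc_single)

lemma hc_var_sum: "hc 1 (var_sum S) = var_sum S"
  by (simp only: var_sum_def hc_sum hc_var)

lemma hc_var_sum_power: "hc k (var_sum S ^ k) = var_sum S ^ k"
proof (induction k)
  case 0
  have "hc 0 (const 1) = const 1" by (simp only: hc_single mon_degree_zero simp_thms if_True)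
  then show ?case by simp
next
  case (Suc k)
  have "hc (1 + k) (var_sum S * var_sum S ^ k) = hc 1 (var_sum S) * hc k (var_sum S ^ k)"
    using deg_le_power[OF deg_le_var_sum, of k S] by (intro hc_mult_top deg_le_var_sum) simp
  with Suc show ?case by (simp add: hc_var_sum[simplified])
qed

lemma deriv_single_keys:
  "m' \<in> Poly_Mapping.keys (deriv_along v (Poly_Mapping.single m c)) \<Longrightarrow> mon_degree m = Suc (mon_degree m')"
proof (induction m arbitrary: c m' rule: exponent_induct)
  case (add m j)
  have *: "Poly_Mapping.single (m + Poly_Mapping.single j 1) c = Poly_Mapping.single m c * var j"
    by (simp add: var_def mult_single)
  have "deriv_along v (Poly_Mapping.single (m + Poly_Mapping.single j 1) c) =
      deriv_along v (Poly_Mapping.single m c) * var j + Poly_Mapping.single m (c * v $ j)"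
    unfolding * by (simp add: deriv_mult mult_single)
  with add.prems have "m' \<in> Poly_Mapping.keys (deriv_along v (Poly_Mapping.single m c) * var j)
      \<union> Poly_Mapping.keys (Poly_Mapping.single m (c * v $ j))"
    using keys_add[of "deriv_along v (Poly_Mapping.single m c) * var j"] by fastforce
  with keys_mult[of "deriv_along v (Poly_Mapping.single m c)" "var j"] add.IH
  show ?case by (fastforce simp: mon_degree_add var_def split: if_splits)
qed simp

lemma hc_deriv: "hc d (deriv_along v f) = deriv_along v (hc (Suc d) f)"
proof (induction f rule: mpoly_additive_induct)
  case (single m c)
  let ?g = "deriv_along v (Poly_Mapping.single m c)"
  have "Poly_Mapping.lookup (hc d ?g) m' = Poly_Mapping.lookup (if mon_degree m = Suc d then ?g else 0) m'"
    for m' using deriv_single_keys[of m' v m c]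
    by (cases "Poly_Mapping.lookup ?g m' = 0") (auto simp: lookup_hc in_keys_iff)
  then show ?case by (auto simp: hc_single intro: poly_mapping_eqI)
qed (simp_all add: deriv_add hc_add)

lemma deg_le_deriv:
  assumes "deg_le (Suc d) f"
  shows "deg_le d (deriv_along v f)"
proof -
  have "Poly_Mapping.lookup (deriv_along v f) m = 0" if "mon_degree m > d" for m
  proof -
    have "hc (mon_degree m) (deriv_along v f) = 0"
      using that assms by (simp add: hc_deriv hc_eq_zero)
    from arg_cong[OF this, of "\<lambda>g. Poly_Mapping.lookup g m"] show ?thesis by (simp add: lookup_hc)
  qed
  then show ?thesis by (simp add: deg_le_iff_lookup)
qed

lemma deriv_deg_le_0:
  assumes "deg_le 0 f"
  shows "deriv_along v f = 0"
  by (subst deg_le_0_conv[OF assms]) simp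

lemma deg_le_const_mult: "deg_le d f \<Longrightarrow> deg_le d (const a * f)"
  using deg_le_mult[OF deg_le_const[of 0 a]] by simp

lemma coeff_line_eq_zero: "deg_le d f \<Longrightarrow> d < k \<Longrightarrow> coeff (line v f) k = 0"
proof (induction k arbitrary: d f)
  case (Suc k)
  show ?case
  proof (cases d)
    case 0
    then show ?thesis using Suc.prems by (simp add: coeff_line_Suc_eq deriv_deg_le_0 line_zero)
  next
    case (Suc d')
    with Suc.prems Suc.IH[of d' "deriv_along v f"] show ?thesis
      by (simp add: coeff_line_Suc_eq deg_le_deriv)
  qed
qed simp

lemma deg_le_coeff_line: "deg_le (d + k) f \<Longrightarrow> deg_le d (coeff (line v f) k)"
  by (induction k arbitrary: f)
    (simp_all add: coeff_line_0 coeff_line_Suc_eq deg_le_const_mult deg_le_deriv)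

lemma difference_0: "deg_le 0 f \<Longrightarrow> difference v f = 0"
  by (simp add: difference_conv_sum[of 0] coeff_line_eq_zero)

text \<open>
  Only the linear Taylor term contributes in degree \<open>d\<close>: the difference operator has the
  derivative as its leading part.
\<close>

lemma difference_leading:
  assumes "deg_le (Suc d) f"
  shows "deg_le d (difference v f)" "hc d (difference v f) = deriv_along v (hc (Suc d) f)"
proof -
  have eq: "difference v f = deriv_along v f + (\<Sum>k\<in>{2..Suc d}. coeff (line v f) k)"
  proof -
    have "{1..Suc d} = insert 1 {2..Suc d}" by auto
    then show ?thesis
      using difference_conv_sum[of "Suc d" v f] assms
      by (simp add: coeff_line_eq_zero deriv_along_def)
  qed
  have "deg_le (d + 1 - k) (coeff (line v f) k)" if "k \<in> {2..Suc d}" for k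
    using assms that by (intro deg_le_coeff_line) simp
  then have *: "deg_le (d - 1) (coeff (line v f) k)" if "k \<in> {2..Suc d}" for k
    using that deg_le_mono[of "d + 1 - k" _ "d - 1"] by force
  show "deg_le d (difference v f)"
    unfolding eq by (intro deg_le_add deg_le_deriv assms deg_le_sum deg_le_mono[OF *]) auto
  have "hc d (\<Sum>k\<in>{2..Suc d}. coeff (line v f) k) = 0"
    unfolding hc_sum by (intro sum.neutral ballI hc_eq_zero[OF *]) auto
  then show "hc d (difference v f) = deriv_along v (hc (Suc d) f)"
    by (simp add: eq hc_add hc_deriv)
qed

lemma deriv_zero_imp_difference_zero: "deriv_along v f = 0 \<Longrightarrow> difference v f = 0"
proof -
  assume *: "deriv_along v f = 0"
  have "coeff (line v f) k = 0" if "0 < k" for k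
    using coeff_line_of_constant[OF *] that by (cases k) auto
  then show ?thesis by (simp add: difference_conv_sum[of 0])
qed

text \<open>
  Over the rationals a polynomial that is invariant under the translation by \<open>v\<close> is constant along
  \<open>v\<close>. Its leading component has derivative \<open>0\<close>, is therefore invariant as well, and can be split off.
\<close>

lemma difference_zero_imp_deriv_zero:
  "deg_le d f \<Longrightarrow> difference v f = 0 \<Longrightarrow> deriv_along v f = 0"
proof (induction d arbitrary: f)
  case 0
  then show ?case by (simp add: deriv_deg_le_0)
next
  case (Suc d)
  let ?h = "hc (Suc d) f"
  have h: "deriv_along v ?h = 0"
    using difference_leading(2)[OF Suc.prems(1), of v] Suc.prems(2) by simp
  have "deg_le d (f - ?h)"
    by (rule deg_le_lower) (simp_all add: hc_diff hc_hc deg_le_diff Suc.prems deg_le_hc)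
  moreover have "difference v (f - ?h) = 0"
    using h Suc.prems by (simp add: difference_diff deriv_zero_imp_difference_zero)
  ultimately have "deriv_along v (f - ?h) = 0" by (rule Suc.IH)
  then show ?case by (simp add: deriv_diff h)
qed

lemma euler_identity:
  "(\<Sum>i\<in>UNIV. var i * deriv_along (axis i 1) (hc d f)) = const (of_nat d) * hc d f"
proof -
  have mon: "(\<Sum>i\<in>UNIV. var i * deriv_along (axis i 1) (Poly_Mapping.single m c)) =
      const (of_nat (mon_degree m)) * (Poly_Mapping.single m c :: 'a mpoly)" for m c
  proof (induction m arbitrary: c rule: exponent_induct)
    case (add m j)
    let ?g = "Poly_Mapping.single m c :: 'a mpoly"
    have *: "Poly_Mapping.single (m + Poly_Mapping.single j 1) c = ?g * var j"
      by (simp add: var_def mult_single)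
    have "(\<Sum>i\<in>UNIV. var i * deriv_along (axis i 1) (?g * var j)) =
       (\<Sum>i\<in>UNIV. var i * deriv_along (axis i 1) ?g) * var j
        + ?g * (\<Sum>i\<in>UNIV. var i * const (axis i 1 $ j))"
      by (simp add: deriv_mult distrib_left sum.distrib sum_distrib_left sum_distrib_right ac_simps)
    also have "(\<Sum>i\<in>UNIV. var i * const (axis i 1 $ j) :: 'a mpoly) = var j"
      by (simp add: axis_def if_distrib[of const] if_distrib[of "(*) _"] cong: if_cong)
    finally show ?case
      unfolding * add.IH by (simp add: mon_degree_add const_add algebra_simps)
  qed simp
  show ?thesis
    by (induction f rule: mpoly_additive_induct)
      (auto simp: hc_add deriv_add distrib_left sum.distrib hc_single mon)
qed

section \<open>Power ideals in rings of invariant polynomials\<close>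

text \<open>
  For \<open>V\<close> spanned by the vectors \<open>e\<^sub>a - e\<^sub>b\<close> of contracted edges this is the coordinate ring of the
  contracted graph, realized inside the ring of the original graph. In this way minors need no new
  vertex type.
\<close>

definition inv_ring :: "(rat ^ 'n) set \<Rightarrow> 'n::finite mpoly set" where
  "inv_ring V = {f. \<forall>v\<in>V. deriv_along v f = 0}"

lemma inv_ring_const [simp]: "const a \<in> inv_ring V"
  and inv_ring_zero [simp]: "0 \<in> inv_ring V"
  and inv_ring_one [simp]: "1 \<in> inv_ring V"
  and inv_ring_add: "f \<in> inv_ring V \<Longrightarrow> g \<in> inv_ring V \<Longrightarrow> f + g \<in> inv_ring V"
  and inv_ring_diff: "f \<in> inv_ring V \<Longrightarrow> g \<in> inv_ring V \<Longrightarrow> f - g \<in> inv_ring V"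
  and inv_ring_mult: "f \<in> inv_ring V \<Longrightarrow> g \<in> inv_ring V \<Longrightarrow> f * g \<in> inv_ring V"
  and inv_ring_sum: "(\<And>a. a \<in> A \<Longrightarrow> k a \<in> inv_ring V) \<Longrightarrow> sum k A \<in> inv_ring V"
  and inv_ring_deriv: "f \<in> inv_ring V \<Longrightarrow> deriv_along w f \<in> inv_ring V"
  and inv_ring_difference: "f \<in> inv_ring V \<Longrightarrow> difference w f \<in> inv_ring V"
  by (auto simp: inv_ring_def deriv_add deriv_diff deriv_mult deriv_sum deriv_difference_zero
      deriv_commute[of _ w])

lemma inv_ring_hc: "f \<in> inv_ring V \<Longrightarrow> hc d f \<in> inv_ring V"
proof (cases d)
  case 0
  then show ?thesis by (simp add: hc_0_conv)
next
  case (Suc e)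
  assume "f \<in> inv_ring V"
  then show ?thesis by (simp add: Suc inv_ring_def hc_deriv[symmetric])
qed

lemma inv_ring_power: "f \<in> inv_ring V \<Longrightarrow> f ^ k \<in> inv_ring V"
  by (induction k) (simp_all add: inv_ring_mult)

lemma inv_ring_antimono: "V \<subseteq> W \<Longrightarrow> inv_ring W \<subseteq> inv_ring V"
  by (auto simp: inv_ring_def)

definition power_ideal ::
    "(rat ^ 'n) set \<Rightarrow> 'n set set \<Rightarrow> ('n set \<Rightarrow> nat) \<Rightarrow> 'n::finite mpoly set" where
  "power_ideal V SS p =
     {\<Sum>S\<in>SS. r S * var_sum S ^ p S | r. \<forall>S\<in>SS. r S \<in> inv_ring V}"

lemma power_idealE:
  assumes "g \<in> power_ideal V SS p"
  obtains r where "g = (\<Sum>S\<in>SS. r S * var_sum S ^ p S)" "\<And>S. S \<in> SS \<Longrightarrow> r S \<in> inv_ring V"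
  using assms by (auto simp: power_ideal_def)

lemma power_idealI:
  "(\<And>S. S \<in> SS \<Longrightarrow> r S \<in> inv_ring V) \<Longrightarrow> g = (\<Sum>S\<in>SS. r S * var_sum S ^ p S) \<Longrightarrow>
    g \<in> power_ideal V SS p"
  by (auto simp: power_ideal_def)

lemma power_ideal_zero: "0 \<in> power_ideal V SS p"
  by (rule power_idealI[of _ "\<lambda>_. 0"]) simp_all

lemma power_ideal_add:
  assumes "f \<in> power_ideal V SS p" "g \<in> power_ideal V SS p"
  shows "f + g \<in> power_ideal V SS p"
proof -
  obtain r where r: "f = (\<Sum>S\<in>SS. r S * var_sum S ^ p S)" "\<And>S. S \<in> SS \<Longrightarrow> r S \<in> inv_ring V"
    using assms(1) by (rule power_idealE) (rule that)
  obtain s where s: "g = (\<Sum>S\<in>SS. s S * var_sum S ^ p S)" "\<And>S. S \<in> SS \<Longrightarrow> s S \<in> inv_ring V"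
    using assms(2) by (rule power_idealE) (rule that)
  have "f + g = (\<Sum>S\<in>SS. (r S + s S) * var_sum S ^ p S)"
    by (simp add: r(1) s(1) distrib_right sum.distrib)
  with r(2) s(2) show ?thesis by (intro power_idealI[of _ "\<lambda>S. r S + s S"] inv_ring_add)
qed

lemma power_ideal_sum:
  "(\<And>a. a \<in> A \<Longrightarrow> k a \<in> power_ideal V SS p) \<Longrightarrow> sum k A \<in> power_ideal V SS p"
  by (induction A rule: infinite_finite_induct) (auto intro: power_ideal_zero power_ideal_add)

lemma power_ideal_mult:
  assumes "g \<in> power_ideal V SS p" "f \<in> inv_ring V"
  shows "f * g \<in> power_ideal V SS p"
proof -
  obtain r where r: "g = (\<Sum>S\<in>SS. r S * var_sum S ^ p S)" "\<And>S. S \<in> SS \<Longrightarrow> r S \<in> inv_ring V"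
    using assms(1) by (rule power_idealE) (rule that)
  have "f * g = (\<Sum>S\<in>SS. (f * r S) * var_sum S ^ p S)"
    by (simp add: r(1) sum_distrib_left mult.assoc)
  with r(2) assms(2) show ?thesis by (intro power_idealI[of _ "\<lambda>S. f * r S"] inv_ring_mult)
qed

lemma power_ideal_generator:
  fixes SS :: "'n::finite set set"
  assumes "S \<in> SS" "g \<in> inv_ring V"
  shows "g * var_sum S ^ p S \<in> power_ideal V SS p"
proof -
  have "g * var_sum S ^ p S = (\<Sum>T\<in>SS. (if T = S then g else 0) * var_sum T ^ p T)"
    using assms(1) by (simp add: if_distrib[of "\<lambda>r. r * _"] cong: if_cong)
  with assms(2) show ?thesis by (intro power_idealI[of _ "\<lambda>T. if T = S then g else 0"]) simp_all
qed

lemma power_ideal_mono: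
  fixes SS :: "'n::finite set set"
  assumes "g \<in> power_ideal W SS' p'"
    and "V \<subseteq> W" "SS' \<subseteq> SS" "\<And>S. S \<in> SS' \<Longrightarrow> p' S = p S"
  shows "g \<in> power_ideal V SS p"
proof -
  obtain r where r: "g = (\<Sum>S\<in>SS'. r S * var_sum S ^ p' S)" "\<And>S. S \<in> SS' \<Longrightarrow> r S \<in> inv_ring W"
    using assms(1) by (rule power_idealE) (rule that)
  have "r S * var_sum S ^ p' S \<in> power_ideal V SS p" if "S \<in> SS'" for S
    using power_ideal_generator[of S SS "r S" V p] r(2)[OF that] assms inv_ring_antimono[OF assms(2)]
      that by auto
  then show ?thesis unfolding r(1) by (rule power_ideal_sum)
qed

lemma hc_generator:
  "hc d (r * var_sum S ^ k) = (if k \<le> d then hc (d - k) r * var_sum S ^ k else 0)"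
  using hc_mult_hc[of d r k "var_sum S ^ k"] by (simp only: hc_var_sum_power)

lemma power_ideal_hc:
  fixes SS :: "'n::finite set set"
  assumes "g \<in> power_ideal V SS p"
  shows "hc d g \<in> power_ideal V SS p"
proof -
  obtain r where r: "g = (\<Sum>S\<in>SS. r S * var_sum S ^ p S)" "\<And>S. S \<in> SS \<Longrightarrow> r S \<in> inv_ring V"
    using assms by (rule power_idealE) (rule that)
  show ?thesis unfolding r(1) hc_sum hc_generator
    by (intro power_ideal_sum) (auto intro: power_ideal_generator power_ideal_zero inv_ring_hc r(2))
qed

text \<open>
  If \<open>x\<^sub>S\<close> takes at most \<open>k\<close> values on \<open>Y\<close>, then \<open>x\<^sub>S ^ k\<close> is the leading form of a product of
  linear factors, one for each value, that vanishes on \<open>Y\<close>.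
\<close>

lemma vanishing_product:
  fixes Y :: "(rat ^ 'n::finite) set"
  assumes "finite A" "card A \<le> k" "\<And>y. y \<in> Y \<Longrightarrow> (\<Sum>i\<in>S. y $ i) \<in> A" "var_sum S \<in> inv_ring V"
  obtains w where "w \<in> inv_ring V" "deg_le k w" "hc k w = var_sum S ^ k" "\<And>y. y \<in> Y \<Longrightarrow> eval y w = 0"
proof -
  let ?x = "var_sum S" and ?P = "\<lambda>A. \<Prod>a\<in>A. var_sum S - const a"
  have lin: "deg_le 1 (?x - const a)" "hc 1 (?x - const a) = ?x" for a
    by (simp_all only: deg_le_diff[OF deg_le_var_sum deg_le_const] hc_diff hc_var_sum)
      (simp add: hc_single)
  have P: "?P A \<in> inv_ring V \<and> deg_le (card A) (?P A) \<and> hc (card A) (?P A) = ?x ^ card A"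
    using assms(1)
  proof (induction A rule: finite_induct)
    case empty
    show ?case using hc_var_sum_power[of 0] by simp
  next
    case (insert a A)
    then show ?case
      using deg_le_mult[OF lin(1)[of a], of "card A" "?P A"]
        hc_mult_top[OF lin(1)[of a], of "card A" "?P A"] lin(2)[of a] assms(4)
      by (simp add: inv_ring_mult inv_ring_diff)
  qed
  let ?w = "?P A * ?x ^ (k - card A)"
  have deg: "deg_le (k - card A) (?x ^ (k - card A))"
    using deg_le_power[OF deg_le_var_sum, of "k - card A" S] by simp
  have "?w \<in> inv_ring V"
    using P assms(4) by (intro inv_ring_mult inv_ring_power) auto
  moreover have "deg_le k ?w"
    using deg_le_mult[of "card A" "?P A", OF _ deg] P assms(2) by simp
  moreover have "hc k ?w = ?x ^ k"
    using hc_mult_top[of "card A" "?P A", OF _ deg] P assms(2)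
    by (simp add: hc_var_sum_power power_add[symmetric])
  moreover have "eval y ?w = 0" if "y \<in> Y" for y
    using assms(1) assms(3)[OF that]
    by (auto simp: eval_mult eval_prod eval_diff eval_var_sum)
  ultimately show thesis by (rule that)
qed

definition few_values :: "'n set set \<Rightarrow> ('n set \<Rightarrow> nat) \<Rightarrow> (rat ^ 'n::finite) set \<Rightarrow> bool" where
  "few_values SS p Y \<longleftrightarrow>
     (\<forall>S\<in>SS. \<exists>A. finite A \<and> card A \<le> p S \<and> (\<forall>y\<in>Y. (\<Sum>i\<in>S. y $ i) \<in> A))"

text \<open>
  Each power is replaced by the vanishing product that it leads, and its coefficient by the
  component of complementary degree, so that the total degree does not exceed \<open>d\<close>. The degree is prescribed separately because the component of \<open>g\<close> in that degree may be zero.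
\<close>

lemma vanishing_lift:
  fixes Y :: "(rat ^ 'n::finite) set"
  assumes gens: "\<And>S. S \<in> SS \<Longrightarrow> var_sum S \<in> inv_ring V"
    and few: "few_values SS p Y" and g: "g \<in> power_ideal V SS p"
  obtains g' where "g' \<in> inv_ring V" "deg_le d g'" "hc d g' = hc d g" "\<And>y. y \<in> Y \<Longrightarrow> eval y g' = 0"
proof -
  obtain r where r: "g = (\<Sum>S\<in>SS. r S * var_sum S ^ p S)" "\<And>S. S \<in> SS \<Longrightarrow> r S \<in> inv_ring V"
    using g by (rule power_idealE) (rule that)
  have "\<forall>S\<in>SS. \<exists>w. w \<in> inv_ring V \<and> deg_le (p S) w \<and> hc (p S) w = var_sum S ^ p S
      \<and> (\<forall>y\<in>Y. eval y w = 0)"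
  proof
    fix S assume S: "S \<in> SS"
    then obtain A where "finite A" "card A \<le> p S" "\<And>y. y \<in> Y \<Longrightarrow> (\<Sum>i\<in>S. y $ i) \<in> A"
      using few by (auto simp: few_values_def)
    from vanishing_product[OF this gens[OF S]] show "\<exists>w. w \<in> inv_ring V \<and> deg_le (p S) w
        \<and> hc (p S) w = var_sum S ^ p S \<and> (\<forall>y\<in>Y. eval y w = 0)"
      by metis
  qed
  from bchoice[OF this] obtain w where w: "\<And>S. S \<in> SS \<Longrightarrow> w S \<in> inv_ring V \<and> deg_le (p S) (w S)
      \<and> hc (p S) (w S) = var_sum S ^ p S \<and> (\<forall>y\<in>Y. eval y (w S) = 0)"
    by blast
  define h where "h S = (if p S \<le> d then hc (d - p S) (r S) * w S else 0)" for S
  have h: "deg_le d (h S) \<and> hc d (h S) = hc d (r S * var_sum S ^ p S)" if "S \<in> SS" for S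
    using deg_le_mult[OF deg_le_hc[of "d - p S" "r S"], of "p S" "w S"]
      hc_mult_top[OF deg_le_hc[of "d - p S" "r S"], of "p S" "w S"] w[OF that]
    by (cases "p S \<le> d") (simp_all add: h_def hc_generator hc_hc)
  show thesis
  proof (rule that)
    show "(\<Sum>S\<in>SS. h S) \<in> inv_ring V"
      using w r(2) by (intro inv_ring_sum) (auto simp: h_def intro!: inv_ring_mult inv_ring_hc)
    show "deg_le d (\<Sum>S\<in>SS. h S)" using h by (intro deg_le_sum) auto
    show "hc d (\<Sum>S\<in>SS. h S) = hc d g" using h by (simp add: hc_sum r(1))
    show "eval y (\<Sum>S\<in>SS. h S) = 0" if "y \<in> Y" for y
      using w that by (auto simp: eval_sum h_def eval_mult intro!: sum.neutral)
  qed
qed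

section \<open>Deletion and contraction\<close>

text \<open>
  The inclusion of the orbit harmonics in the power ideal, relative to an invariant ring. Bounding
  the degree from above instead of fixing it makes the statement apply to the zero polynomial and to
  leading forms that cancel.
\<close>

definition harmonic ::
    "(rat ^ 'n) set \<Rightarrow> 'n set set \<Rightarrow> ('n set \<Rightarrow> nat) \<Rightarrow> (rat ^ 'n::finite) set \<Rightarrow> bool" where
  "harmonic V SS p Y \<longleftrightarrow> (\<forall>d f. f \<in> inv_ring V \<longrightarrow> deg_le d f \<longrightarrow> (\<forall>y\<in>Y. eval y f = 0) \<longrightarrow>
     hc d f \<in> power_ideal V SS p)"

lemma harmonicD:
  "harmonic V SS p Y \<Longrightarrow> f \<in> inv_ring V \<Longrightarrow> deg_le d f \<Longrightarrow> (\<And>y. y \<in> Y \<Longrightarrow> eval y f = 0) \<Longrightarrow>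
   hc d f \<in> power_ideal V SS p"
  by (auto simp: harmonic_def)

text \<open>
  The product rule for \<open>g x\<^bsup>q+1\<^esup> / ((q + 1) s)\<close>, where \<open>s\<close> is the slope of \<open>x\<close> along \<open>v\<close>.
\<close>

lemma by_parts:
  assumes "x \<in> inv_ring V" "deriv_along v x = const s" "s \<noteq> 0" "g \<in> inv_ring V" "deg_le n g"
  shows "\<exists>h\<in>inv_ring V. deg_le n h \<and>
    deriv_along v (h * x ^ Suc q) = deriv_along v h * x ^ Suc q + g * x ^ q"
proof -
  define h where "h = const (1 / (of_nat (Suc q) * s)) * g"
  have "const (of_nat (Suc q)) * (h * const s) = const (1 / (of_nat (Suc q) * s)) * (const (of_nat (Suc q) * s) * g)"
    by (simp only: h_def const_mult mult_ac)
  also have "\<dots> = g" using assms(3) by (intro const_mult_cancel) simp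
  finally have h: "const (of_nat (Suc q)) * (h * const s) = g" .
  have "deriv_along v (h * x ^ Suc q) =
      deriv_along v h * x ^ Suc q + (const (of_nat (Suc q)) * (h * const s)) * x ^ q"
    by (simp only: deriv_mult deriv_power assms(2) mult_ac)
  moreover have "h \<in> inv_ring V" "deg_le n h"
    using assms by (simp_all add: h_def inv_ring_mult deg_le_const_mult)
  ultimately show ?thesis unfolding h by blast
qed

text \<open>The remainder has a coefficient of smaller degree, so that finitely many steps remove it.\<close>

lemma integration_by_parts:
  assumes x: "x \<in> inv_ring V" "deriv_along v x = const s" "s \<noteq> 0"
  shows "g \<in> inv_ring V \<Longrightarrow> deg_le n g \<Longrightarrow>
    \<exists>h\<in>inv_ring V. deriv_along v (h * x ^ Suc q) = g * x ^ q"
proof (induction n arbitrary: g q)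
  case 0
  with by_parts[OF x, of g 0 q] deriv_deg_le_0 show ?case by fastforce
next
  case (Suc n)
  obtain h where h: "h \<in> inv_ring V" "deg_le (Suc n) h"
    "deriv_along v (h * x ^ Suc q) = deriv_along v h * x ^ Suc q + g * x ^ q"
    using by_parts[OF x Suc.prems] by blast
  obtain k where k: "k \<in> inv_ring V"
    "deriv_along v (k * x ^ Suc (Suc q)) = deriv_along v h * x ^ Suc q"
    using Suc.IH[OF inv_ring_deriv deg_le_deriv] h by blast
  have "(h - k * x) * x ^ Suc q = h * x ^ Suc q - k * x ^ Suc (Suc q)"
    by (simp add: left_diff_distrib mult.assoc)
  then have "deriv_along v ((h - k * x) * x ^ Suc q) = g * x ^ q"
    using h(3) k(2) by (simp only: deriv_diff) simp
  moreover have "h - k * x \<in> inv_ring V"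
    using h(1) k(1) x(1) by (intro inv_ring_diff inv_ring_mult)
  ultimately show ?case by blast
qed

lemma ex_deg_le: "\<exists>n. deg_le n f"
  by (rule exI[of _ "Max (insert 0 (mon_degree ` Poly_Mapping.keys f))"]) (auto simp: deg_le_def)

text \<open>
  A generator that is constant along \<open>v\<close> is a scalar for the derivative, so that only its coefficient
  is integrated, with the help of the separating form of \<open>S0\<close>. For any other generator the power of
  the form itself takes part, which raises its exponent by one.
\<close>

lemma deletion_integral:
  fixes SS :: "'n::finite set set"
  assumes gens: "\<And>S. S \<in> SS \<Longrightarrow> var_sum S \<in> inv_ring V"
    and S0: "S0 \<in> SS" "deriv_along v (var_sum S0) \<noteq> 0"
    and p': "\<And>S. S \<in> SS \<Longrightarrow> p S = (if deriv_along v (var_sum S) = 0 then p' S else Suc (p' S))"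
    and a: "a \<in> power_ideal V SS p'"
  shows "\<exists>g\<in>power_ideal V SS p. deriv_along v g = a"
proof -
  obtain r where r: "a = (\<Sum>S\<in>SS. r S * var_sum S ^ p' S)" "\<And>S. S \<in> SS \<Longrightarrow> r S \<in> inv_ring V"
    using a by (rule power_idealE) (rule that)
  have int: "\<exists>h\<in>inv_ring V. deriv_along v (h * var_sum S ^ Suc q) = g * var_sum S ^ q"
    if S: "S \<in> SS" "deriv_along v (var_sum S) \<noteq> 0" and g: "g \<in> inv_ring V" for S q g
  proof -
    obtain n where "deg_le n g" using ex_deg_le by blast
    moreover have "(\<Sum>i\<in>S. v $ i) \<noteq> 0" using S(2) by (auto simp: deriv_var_sum)
    ultimately show ?thesis using integration_by_parts[OF gens[OF S(1)] deriv_var_sum _ g] by blast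
  qed
  have "\<exists>g\<in>power_ideal V SS p. deriv_along v g = r S * var_sum S ^ p' S" if S: "S \<in> SS" for S
  proof (cases "deriv_along v (var_sum S) = 0")
    case True
    obtain h where h: "h \<in> inv_ring V" "deriv_along v (h * var_sum S0 ^ Suc 0) = r S * var_sum S0 ^ 0"
      using int[OF S0 r(2)[OF S]] by blast
    let ?h = "h * var_sum S0"
    have "deriv_along v (var_sum S ^ p S) = 0"
      using True by (cases "p S") (simp_all only: deriv_power mult_zero_right power_0 deriv_one)
    then have "deriv_along v (?h * var_sum S ^ p S) = r S * var_sum S ^ p' S"
      using h(2) p'[OF S] True by (simp add: deriv_mult)
    moreover have "?h * var_sum S ^ p S \<in> power_ideal V SS p"
      using h(1) gens[OF S0(1)] by (intro power_ideal_generator S inv_ring_mult)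
    ultimately show ?thesis by blast
  next
    case False
    with int[OF S False r(2)[OF S], of "p' S"] p'[OF S] power_ideal_generator[OF S, of _ V p]
    show ?thesis by auto
  qed
  then have "\<forall>S\<in>SS. \<exists>g. g \<in> power_ideal V SS p \<and> deriv_along v g = r S * var_sum S ^ p' S"
    by blast
  from bchoice[OF this] obtain k where k: "\<And>S. S \<in> SS \<Longrightarrow> k S \<in> power_ideal V SS p \<and>
      deriv_along v (k S) = r S * var_sum S ^ p' S"
    by blast
  then have "(\<Sum>S\<in>SS. k S) \<in> power_ideal V SS p" "deriv_along v (\<Sum>S\<in>SS. k S) = a"
    by (auto intro: power_ideal_sum simp: deriv_sum r(1))
  then show ?thesis by blast
qed

text \<open>
  For \<open>f\<close> vanishing on \<open>Y\<close>, the difference of \<open>f\<close> along \<open>v\<close> vanishes on \<open>Y'\<close>, so its leading form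
  lies in the ideal of the deletion and can be integrated to an element of the power ideal.
  Subtracting a vanishing polynomial with that leading form lowers the degree of the difference
  and changes the leading form of \<open>f\<close> only within the power ideal. In the end the difference is
  zero, which means that \<open>f\<close> belongs to the invariant ring of the contraction.
\<close>

theorem deletion_contraction:
  fixes SS :: "'n::finite set set"
  assumes gens: "\<And>S. S \<in> SS \<Longrightarrow> var_sum S \<in> inv_ring V"
    and S0: "S0 \<in> SS" "deriv_along v (var_sum S0) \<noteq> 0"
    and p': "\<And>S. S \<in> SS \<Longrightarrow> p S = (if deriv_along v (var_sum S) = 0 then p' S else Suc (p' S))"
    and few: "few_values SS p Y"
    and Y': "\<And>y. y \<in> Y' \<Longrightarrow> y \<in> Y \<and> y + v \<in> Y"
    and deletion: "harmonic V SS p' Y'"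
    and contraction: "harmonic (insert v V) {S \<in> SS. deriv_along v (var_sum S) = 0} p Y"
  shows "harmonic V SS p Y"
  unfolding harmonic_def
proof (intro allI impI)
  fix d f
  assume f: "f \<in> inv_ring V" "deg_le d f" "\<forall>y\<in>Y. eval y f = 0"
  have invariant: "hc d f \<in> power_ideal V SS p"
    if "f \<in> inv_ring V" "deg_le d f" "\<forall>y\<in>Y. eval y f = 0" "difference v f = 0" for f
  proof -
    have "f \<in> inv_ring (insert v V)"
      using that difference_zero_imp_deriv_zero[of d f v] by (simp add: inv_ring_def)
    then have "hc d f \<in> power_ideal (insert v V) {S \<in> SS. deriv_along v (var_sum S) = 0} p"
      using that contraction by (intro harmonicD) auto
    then show ?thesis by (rule power_ideal_mono) auto
  qed
  (* One correction step: remove the component of degree m of the difference. *)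
  have reduce: "\<exists>f'. f' \<in> inv_ring V \<and> deg_le d f' \<and> (\<forall>y\<in>Y. eval y f' = 0) \<and>
      deg_le m (difference v f') \<and> hc m (difference v f') = 0 \<and> hc d (f - f') \<in> power_ideal V SS p"
    if f: "f \<in> inv_ring V" "deg_le d f" "\<forall>y\<in>Y. eval y f = 0" and m: "deg_le m (difference v f)" "m < d"
    for m f
  proof -
    have "hc m (difference v f) \<in> power_ideal V SS p'"
      using f Y' m(1) by (intro harmonicD[OF deletion]) (auto simp: inv_ring_difference eval_difference)
    from deletion_integral[OF gens S0 p' this] obtain g
      where g: "g \<in> power_ideal V SS p" "deriv_along v g = hc m (difference v f)"
      by blast
    obtain g' where g': "g' \<in> inv_ring V" "deg_le (Suc m) g'" "hc (Suc m) g' = hc (Suc m) g"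
      "\<And>y. y \<in> Y \<Longrightarrow> eval y g' = 0"
      using vanishing_lift[OF gens few g(1), of "Suc m"] by blast
    have "hc m (difference v g') = hc m (deriv_along v g)"
      using difference_leading(2)[OF g'(2)] by (simp add: g'(3) hc_deriv)
    then have "hc m (difference v (f - g')) = 0"
      by (simp add: difference_diff hc_diff g(2) hc_hc)
    moreover have "deg_le m (difference v (f - g'))"
      unfolding difference_diff by (intro deg_le_diff m(1) difference_leading(1) g'(2))
    moreover have "hc d g' \<in> power_ideal V SS p"
    proof (cases "d = Suc m")
      case True
      then show ?thesis using g'(3) power_ideal_hc[OF g(1)] by simp
    next
      case False
      then show ?thesis using m(2) hc_eq_zero[OF g'(2), of d] by (simp add: power_ideal_zero)
    qed
    moreover have "f - g' \<in> inv_ring V" "deg_le d (f - g')"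
      using f g' m(2) by (auto intro!: inv_ring_diff deg_le_diff deg_le_mono[OF g'(2)])
    moreover have "\<forall>y\<in>Y. eval y (f - g') = 0"
      using f(3) g'(4) by (simp add: eval_diff)
    ultimately show ?thesis by (intro exI[of _ "f - g'"]) simp
  qed
  have main: "hc d f \<in> power_ideal V SS p"
    if "f \<in> inv_ring V" "deg_le d f" "\<forall>y\<in>Y. eval y f = 0" "deg_le m (difference v f)" "m < d" for m f
    using that
  proof (induction m arbitrary: f)
    case (0 f)
    from reduce[OF this] obtain f' where f': "f' \<in> inv_ring V" "deg_le d f'" "\<forall>y\<in>Y. eval y f' = 0"
      "deg_le 0 (difference v f')" "hc 0 (difference v f') = 0" "hc d (f - f') \<in> power_ideal V SS p"
      by blast
    have "difference v f' = 0"
      using deg_le_0_conv[OF f'(4)] f'(5) by (simp add: hc_0_conv)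
    from power_ideal_add[OF f'(6) invariant[OF f'(1-3) this]] show ?case by (simp add: hc_diff)
  next
    case (Suc m f)
    from reduce[OF this(2-)] obtain f' where f': "f' \<in> inv_ring V" "deg_le d f'" "\<forall>y\<in>Y. eval y f' = 0"
      "deg_le (Suc m) (difference v f')" "hc (Suc m) (difference v f') = 0"
      "hc d (f - f') \<in> power_ideal V SS p"
      by blast
    have "hc d f' \<in> power_ideal V SS p"
      using Suc.prems(5) by (intro Suc.IH f' deg_le_lower) simp
    from power_ideal_add[OF f'(6) this] show ?case by (simp add: hc_diff)
  qed
  show "hc d f \<in> power_ideal V SS p"
  proof (cases d)
    case 0
    with f show ?thesis by (intro invariant difference_0) auto
  next
    case (Suc e)
    with f difference_leading(1)[of e f v] show ?thesis by (intro main[of f e]) auto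
  qed
qed

lemma deriv_direction_diff: "deriv_along (v - w) f = deriv_along v f - deriv_along w f"
  by (induction f rule: mpoly_induct)
    (simp_all add: deriv_add deriv_mult left_diff_distrib right_diff_distrib single_diff)

text \<open>The vectors along which polynomials become constant when pairs of variables are identified.\<close>

definition edge_vectors :: "('n \<times> 'n) set \<Rightarrow> (rat ^ 'n::finite) set" where
  "edge_vectors K = {axis a 1 - axis b 1 | a b. (a, b) \<in> K}"

definition unions_of_classes :: "('n \<times> 'n) set \<Rightarrow> 'n set set" where
  "unions_of_classes K = {S. \<forall>(a, b)\<in>K. a \<in> S \<longleftrightarrow> b \<in> S}"

lemma const_eq_0: "const a = 0 \<longleftrightarrow> a = 0"
  by (metis lookup_single_eq lookup_zero single_zero)

lemma sum_axis: "(\<Sum>i\<in>S. (axis a 1 :: rat ^ 'n::finite) $ i) = (if a \<in> S then 1 else 0)"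
  by (simp add: axis_def)

lemma deriv_edge_var_sum:
  "deriv_along (axis a 1 - axis b 1) (var_sum S) =
     const ((if a \<in> S then 1 else 0) - (if b \<in> S then 1 else 0))"
  unfolding deriv_direction_diff by (simp only: deriv_var_sum sum_axis single_diff)

lemma deriv_edge_var_sum_zero:
  "deriv_along (axis a 1 - axis b 1) (var_sum S) = 0 \<longleftrightarrow> (a \<in> S \<longleftrightarrow> b \<in> S)"
  by (simp add: deriv_edge_var_sum const_eq_0)

lemma var_sum_in_inv_ring: "S \<in> unions_of_classes K \<Longrightarrow> var_sum S \<in> inv_ring (edge_vectors K)"
  by (auto simp: inv_ring_def edge_vectors_def unions_of_classes_def deriv_edge_var_sum)

text \<open>
  With no edge left, the leading form of positive degree is, by Euler's identity, a combination of
  its own partial derivatives, and these agree on each class of identified variables.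
\<close>

lemma harmonic_base:
  fixes K :: "('n::finite \<times> 'n) set"
  assumes p: "\<And>S. S \<in> unions_of_classes K \<Longrightarrow> p S = 1" and "y \<in> Y"
  shows "harmonic (edge_vectors K) (unions_of_classes K) p Y"
  unfolding harmonic_def
proof (intro allI impI)
  let ?V = "edge_vectors K" and ?SS = "unions_of_classes K"
  fix d f
  assume f: "f \<in> inv_ring ?V" "deg_le d f" "\<forall>y\<in>Y. eval y f = 0"
  let ?h = "hc d f"
  show "?h \<in> power_ideal ?V ?SS p"
  proof (cases "d = 0")
    case True
    then have eq: "f = const (Poly_Mapping.lookup f 0)" using f by (intro deg_le_0_conv) simp
    have "Poly_Mapping.lookup f 0 = 0"
      using f(3) \<open>y \<in> Y\<close> eval_const[of y "Poly_Mapping.lookup f 0"] unfolding eq[symmetric] by simp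
    with eq have "f = 0" by simp
    then show ?thesis by (simp add: power_ideal_zero)
  next
    case False
    define g where "g i = deriv_along (axis i 1) ?h" for i
    define C where "C i = {j. \<forall>S\<in>?SS. i \<in> S \<longleftrightarrow> j \<in> S}" for i
    have g_inv: "g i \<in> inv_ring ?V" for i
      by (simp add: g_def inv_ring_deriv inv_ring_hc f)
    have C_in: "C i \<in> ?SS" for i
      by (auto simp: C_def unions_of_classes_def)
    have g_eq: "g j = g i" if "j \<in> C i" for i j
    proof -
      have "g a = g b" if "(a, b) \<in> K" for a b
      proof -
        have "deriv_along (axis a 1 - axis b 1) ?h = 0"
          using inv_ring_hc[OF f(1), of d] that by (auto simp: inv_ring_def edge_vectors_def)
        then show ?thesis by (simp add: g_def deriv_direction_diff)
      qed
      then have "{j. g j = g i} \<in> ?SS"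
        by (auto simp: unions_of_classes_def)
      moreover have "\<forall>S\<in>?SS. i \<in> S \<longleftrightarrow> j \<in> S" using that by (simp add: C_def)
      ultimately have "i \<in> {j. g j = g i} \<longleftrightarrow> j \<in> {j. g j = g i}" by (rule bspec[rotated])
      then show ?thesis by simp
    qed
    have fibre: "{i \<in> UNIV. C i = C a} = C a" for a
      by (auto simp: C_def)
    have "(\<Sum>i\<in>UNIV. var i * g i) = (\<Sum>A\<in>range C. \<Sum>i\<in>{i \<in> UNIV. C i = A}. var i * g i)"
      by (rule sum.group[symmetric]) auto
    also have "\<dots> \<in> power_ideal ?V ?SS p"
    proof (rule power_ideal_sum)
      fix A assume "A \<in> range C"
      then obtain a where a: "A = C a" by blast
      have "(\<Sum>i\<in>{i \<in> UNIV. C i = A}. var i * g i) = (\<Sum>i\<in>C a. var i * g a)"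
        unfolding a fibre using g_eq by (intro sum.cong) auto
      also have "\<dots> = g a * var_sum (C a) ^ p (C a)"
        by (simp add: p[OF C_in] var_sum_def sum_distrib_left mult.commute)
      also have "\<dots> \<in> power_ideal ?V ?SS p"
        by (intro power_ideal_generator C_in g_inv)
      finally show "(\<Sum>i\<in>{i \<in> UNIV. C i = A}. var i * g i) \<in> power_ideal ?V ?SS p" .
    qed
    finally have "const (of_nat d) * ?h \<in> power_ideal ?V ?SS p"
      by (simp add: g_def euler_identity)
    from power_ideal_mult[OF this, of "const (1 / of_nat d)"]
    have "const (1 / of_nat d) * (const (of_nat d) * ?h) \<in> power_ideal ?V ?SS p" by simp
    also have "const (1 / of_nat d) * (const (of_nat d) * ?h) = ?h"
      using False by (intro const_mult_cancel) simp
    finally show ?thesis .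
  qed
qed

text \<open>
  A polynomial that is invariant under \<open>v\<close> vanishes at \<open>y\<close> as soon as it vanishes at \<open>y - v\<close>. For a
  contracted edge this makes it irrelevant at which of its ends the edge is counted.
\<close>

lemma harmonic_transfer:
  fixes SS :: "'n::finite set set"
  assumes harm: "harmonic V SS p' Y'" and p: "\<And>S. S \<in> SS \<Longrightarrow> p' S = p S"
    and Y: "\<And>y. y \<in> Y' \<Longrightarrow> y \<in> Y \<or> (\<exists>v\<in>V. y - v \<in> Y)"
  shows "harmonic V SS p Y"
  unfolding harmonic_def
proof (intro allI impI)
  fix d f
  assume f: "f \<in> inv_ring V" "deg_le d f" "\<forall>y\<in>Y. eval y f = 0"
  have "eval y f = 0" if "y \<in> Y'" for y
  proof -
    have "eval y f = eval (y - v) f" if "v \<in> V" for v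
      using f(1) that eval_difference[of "y - v" v f]
      by (simp add: inv_ring_def deriv_zero_imp_difference_zero)
    with Y[OF that] f(3) show ?thesis by metis
  qed
  with harm f have "hc d f \<in> power_ideal V SS p'" by (auto intro: harmonicD)
  then show "hc d f \<in> power_ideal V SS p"
    by (rule power_ideal_mono) (auto simp: p)
qed

lemma harmonic_of_unit_generator:
  fixes SS :: "'n::finite set set"
  assumes "S \<in> SS" "p S = 0"
  shows "harmonic V SS p Y"
  unfolding harmonic_def
  using power_ideal_generator[OF assms(1) inv_ring_hc, where p = p] assms(2) by fastforce

section \<open>Boundaries and indegrees\<close>

lemma boundary_insert:
  assumes "ends e = {a, b}"
  shows "boundary (insert e E) ends S =
    (if a \<in> S \<longleftrightarrow> b \<in> S then boundary (E - {e}) ends S else insert e (boundary (E - {e}) ends S))"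
  using assms by (auto simp: boundary_def doubleton_eq_iff)

lemma finite_boundary: "finite E \<Longrightarrow> finite (boundary E ends S)"
  by (simp add: boundary_def)

lemma boundary_trivial [simp]:
  "boundary E ends {} = {}" "boundary E ends UNIV = {}" "boundary {} ends S = {}"
  by (auto simp: boundary_def)

lemma boundary_Compl: "boundary E ends (- S) = boundary E ends S"
  by (auto simp: boundary_def insert_commute)

lemma boundary_iff:
  "ends e = {a, b} \<Longrightarrow> e \<in> boundary E ends S \<longleftrightarrow> e \<in> E \<and> (a \<in> S \<longleftrightarrow> b \<notin> S)"
  by (auto simp: boundary_def doubleton_eq_iff)

definition indeg_vec :: "'e set \<Rightarrow> ('e \<Rightarrow> 'n) \<Rightarrow> rat ^ 'n::finite" where
  "indeg_vec E h = (\<chi> i. of_nat (indeg E h i))"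

lemma indeg_vec_insert:
  assumes "finite E" "e \<notin> E"
  shows "indeg_vec (insert e E) h = axis (h e) 1 + indeg_vec E h"
proof -
  have "{x \<in> insert e E. h x = i} = (if h e = i then insert e {x \<in> E. h x = i} else {x \<in> E. h x = i})" for i
    by auto
  then show ?thesis using assms
    by (auto simp: indeg_vec_def indeg_def vec_eq_iff axis_def)
qed

lemma indeg_vec_upd: "e \<notin> E \<Longrightarrow> indeg_vec E (h(e := a)) = indeg_vec E h"
  unfolding indeg_vec_def indeg_def vec_eq_iff by (auto intro!: arg_cong[of _ _ card])

lemma sum_indeg_vec:
  assumes "finite E"
  shows "(\<Sum>i\<in>S. indeg_vec E h $ i) = of_nat (card {e \<in> E. h e \<in> S})"
proof -
  have "card {e \<in> E. h e \<in> S} = card (\<Union>i\<in>S. {e \<in> E. h e = i})"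
    by (rule arg_cong[of _ _ card]) auto
  also have "\<dots> = (\<Sum>i\<in>S. card {e \<in> E. h e = i})"
    using assms by (intro card_UN_disjoint) auto
  finally show ?thesis by (simp add: indeg_vec_def indeg_def)
qed

text \<open>
  The edges inside \<open>S\<close> contribute to the indegree sum over \<open>S\<close> whatever the orientation is; only the
  edges of the cut vary.
\<close>

lemma card_heads_in:
  assumes "finite E" "\<And>e. e \<in> E \<Longrightarrow> card (ends e) = 2" "orientation E ends h"
  shows "card {e \<in> E. h e \<in> S} =
    card {e \<in> E. ends e \<subseteq> S} + card {e \<in> boundary E ends S. h e \<in> S}"
proof -
  have "{e \<in> E. h e \<in> S} = {e \<in> E. ends e \<subseteq> S} \<union> {e \<in> boundary E ends S. h e \<in> S}"
  proof (intro set_eqI)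
    fix e
    show "e \<in> {e \<in> E. h e \<in> S} \<longleftrightarrow> e \<in> {e \<in> E. ends e \<subseteq> S} \<union> {e \<in> boundary E ends S. h e \<in> S}"
    proof (cases "e \<in> E")
      case True
      then obtain a b where "ends e = {a, b}" using assms(2) by (meson card_2_iff)
      with True assms(3) show ?thesis by (auto simp: boundary_iff orientation_def)
    qed (auto simp: boundary_def)
  qed
  moreover have "{e \<in> E. ends e \<subseteq> S} \<inter> {e \<in> boundary E ends S. h e \<in> S} = {}"
    by (auto simp: boundary_def)
  ultimately show ?thesis
    using assms(1) by (simp add: card_Un_disjoint finite_boundary)
qed

section \<open>The external algebra\<close>

definition external_exponent :: "'e set \<Rightarrow> ('e \<Rightarrow> 'n::finite set) \<Rightarrow> 'n set \<Rightarrow> nat" where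
  "external_exponent E ends S = card (boundary E ends S) + 1"

text \<open>The base point \<open>c\<close> records the heads of the edges removed so far.\<close>

definition external_points ::
    "rat ^ 'n \<Rightarrow> 'e set \<Rightarrow> ('e \<Rightarrow> 'n::finite set) \<Rightarrow> (rat ^ 'n) set" where
  "external_points c E ends = {c + indeg_vec E h | h. orientation E ends h}"

lemma few_values_external:
  fixes ends :: "'e \<Rightarrow> 'n::finite set"
  assumes E: "finite E" "\<And>e. e \<in> E \<Longrightarrow> card (ends e) = 2"
  shows "few_values SS (external_exponent E ends) (external_points c E ends)"
  unfolding few_values_def
proof
  fix S :: "'n set" assume "S \<in> SS"
  let ?m = "card {e \<in> E. ends e \<subseteq> S}" and ?d = "card (boundary E ends S)"
  let ?A = "(\<lambda>k. (\<Sum>i\<in>S. c $ i) + of_nat k) ` {?m..?m + ?d}"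
  have "(\<Sum>i\<in>S. y $ i) \<in> ?A" if "y \<in> external_points c E ends" for y
  proof -
    obtain h where h: "y = c + indeg_vec E h" "orientation E ends h"
      using \<open>y \<in> external_points c E ends\<close> by (auto simp: external_points_def)
    have "card {e \<in> boundary E ends S. h e \<in> S} \<le> ?d"
      by (intro card_mono finite_boundary E) auto
    then have "card {e \<in> E. h e \<in> S} \<in> {?m..?m + ?d}"
      using card_heads_in[OF E h(2)] by simp
    then show ?thesis by (simp add: h(1) sum.distrib sum_indeg_vec[OF E(1)])
  qed
  moreover have "card ?A \<le> external_exponent E ends S"
    using card_image_le[of "{?m..?m + ?d}" "\<lambda>k. (\<Sum>i\<in>S. c $ i) + of_nat k"]
    by (simp add: external_exponent_def)
  ultimately show "\<exists>A. finite A \<and> card A \<le> external_exponent E ends S \<and>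
      (\<forall>y\<in>external_points c E ends. (\<Sum>i\<in>S. y $ i) \<in> A)"
    by (intro exI[of _ ?A]) auto
qed

lemma external_points_insert:
  assumes "finite E" "e \<notin> E" "a \<in> ends e" "y \<in> external_points (c + axis a 1) E ends"
  shows "y \<in> external_points c (insert e E) ends"
proof -
  obtain h where h: "y = c + axis a 1 + indeg_vec E h" "orientation E ends h"
    using assms(4) by (auto simp: external_points_def)
  have "y = c + indeg_vec (insert e E) (h(e := a))"
    using assms by (simp add: h(1) indeg_vec_insert indeg_vec_upd add.assoc)
  moreover have "orientation (insert e E) ends (h(e := a))"
    using h(2) assms by (auto simp: orientation_def)
  ultimately show ?thesis unfolding external_points_def by blast
qed

lemma unions_of_classes_insert:
  "unions_of_classes (insert (a, b) K) = {S \<in> unions_of_classes K. a \<in> S \<longleftrightarrow> b \<in> S}"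
  by (auto simp: unions_of_classes_def)

lemma edge_vectors_insert:
  "edge_vectors (insert (a, b) K) = insert (axis a 1 - axis b 1) (edge_vectors K)"
  by (auto simp: edge_vectors_def)

text \<open>
  Contraction is recorded by adding a pair to \<open>K\<close>, deletion by moving the base point. An edge whose
  ends are already identified has a fixed contribution and is dropped after directing it arbitrarily.
\<close>

lemma external_harmonic:
  fixes ends :: "'e \<Rightarrow> 'n::finite set"
  assumes "finite E" "\<And>e. e \<in> E \<Longrightarrow> card (ends e) = 2"
  shows "harmonic (edge_vectors K) (unions_of_classes K) (external_exponent E ends)
    (external_points c E ends)"
  using assms
proof (induction E arbitrary: K c rule: finite_induct)
  case empty
  show ?case
    by (rule harmonic_base[where y = "c + indeg_vec {} (undefined :: 'e \<Rightarrow> 'n)"])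
      (auto simp: external_exponent_def external_points_def orientation_def)
next
  case (insert e E)
  obtain a b where ab: "ends e = {a, b}" "a \<noteq> b"
    using insert.prems[of e] by (auto simp: card_2_iff)
  have exponent: "external_exponent (insert e E) ends S =
      (if a \<in> S \<longleftrightarrow> b \<in> S then external_exponent E ends S else Suc (external_exponent E ends S))" for S
  proof -
    have "e \<notin> boundary E ends S" using insert.hyps by (auto simp: boundary_def)
    then show ?thesis
      using insert.hyps by (simp add: external_exponent_def boundary_insert[where ends = ends and e = e, OF ab(1)] finite_boundary)
  qed
  have IH: "harmonic (edge_vectors K) (unions_of_classes K) (external_exponent E ends)
      (external_points c E ends)" for K c
    using insert by auto
  have Y: "y \<in> external_points c (insert e E) ends"
    if "y \<in> external_points (c + axis u 1) E ends" "u \<in> ends e" for y u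
    using external_points_insert insert.hyps that by metis
  show ?case
  proof (cases "\<forall>S\<in>unions_of_classes K. a \<in> S \<longleftrightarrow> b \<in> S")
    case True
    show ?thesis
      by (rule harmonic_transfer[OF IH[of K "c + axis a 1"]]) (use True Y ab exponent in auto)
  next
    case False
    then obtain S0 where S0: "S0 \<in> unions_of_classes K" "\<not> (a \<in> S0 \<longleftrightarrow> b \<in> S0)" by blast
    let ?v = "axis a 1 - axis b 1 :: rat ^ 'n"
    show ?thesis
    proof (rule deletion_contraction[where v = ?v and p' = "external_exponent E ends"
          and Y' = "external_points (c + axis b 1) E ends"])
      show "var_sum S \<in> inv_ring (edge_vectors K)" if "S \<in> unions_of_classes K" for S
        using that by (rule var_sum_in_inv_ring)
      show "S0 \<in> unions_of_classes K" "deriv_along ?v (var_sum S0) \<noteq> 0"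
        using S0 by (simp_all add: deriv_edge_var_sum_zero)
      show "external_exponent (insert e E) ends S = (if deriv_along ?v (var_sum S) = 0
          then external_exponent E ends S else Suc (external_exponent E ends S))" for S
        unfolding deriv_edge_var_sum_zero by (rule exponent)
      show "few_values (unions_of_classes K) (external_exponent (insert e E) ends)
          (external_points c (insert e E) ends)"
        using insert by (intro few_values_external) auto
      show "y \<in> external_points c (insert e E) ends \<and> y + ?v \<in> external_points c (insert e E) ends"
        if "y \<in> external_points (c + axis b 1) E ends" for y
      proof
        show "y \<in> external_points c (insert e E) ends" using Y[OF that] ab by simp
        have "y + ?v \<in> external_points (c + axis a 1) E ends"
          using that by (auto simp: external_points_def algebra_simps)
        then show "y + ?v \<in> external_points c (insert e E) ends" using Y ab by simp
      qed
      show "harmonic (edge_vectors K) (unions_of_classes K) (external_exponent E ends)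
          (external_points (c + axis b 1) E ends)"
        by (rule IH)
      have "harmonic (edge_vectors (insert (a, b) K)) (unions_of_classes (insert (a, b) K))
          (external_exponent (insert e E) ends) (external_points c (insert e E) ends)"
        by (rule harmonic_transfer[OF IH[of _ "c + axis a 1"]])
          (use Y ab in \<open>auto simp: exponent unions_of_classes_insert\<close>)
      then show "harmonic (insert ?v (edge_vectors K))
          {S \<in> unions_of_classes K. deriv_along ?v (var_sum S) = 0}
          (external_exponent (insert e E) ends) (external_points c (insert e E) ends)"
        by (simp add: unions_of_classes_insert edge_vectors_insert deriv_edge_var_sum_zero)
    qed
  qed
qed

section \<open>The internal algebra\<close>

text \<open>
  The whole vertex set has the exponent of the linear generator; for the empty set the form is zero
  and its exponent only has to be positive.
\<close>

definition internal_exponent :: "'e set \<Rightarrow> ('e \<Rightarrow> 'n::finite set) \<Rightarrow> 'n set \<Rightarrow> nat" where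
  "internal_exponent E ends S = (if S = {} \<or> S = UNIV then 1 else card (boundary E ends S) - 1)"

text \<open>
  Strong connectivity in terms of cuts: every nontrivial set is entered by an edge. If \<open>SS\<close> consists of
  the unions of classes of vertices, it refers to the graph in which each class is one vertex.
\<close>

definition strong :: "'n set set \<Rightarrow> 'e set \<Rightarrow> ('e \<Rightarrow> 'n set) \<Rightarrow> ('e \<Rightarrow> 'n::finite) \<Rightarrow> bool" where
  "strong SS E ends h \<longleftrightarrow> (\<forall>S\<in>SS. S \<noteq> {} \<longrightarrow> S \<noteq> UNIV \<longrightarrow> (\<exists>e\<in>E. h e \<in> S \<and> \<not> ends e \<subseteq> S))"

definition internal_points ::
    "'n set set \<Rightarrow> rat ^ 'n \<Rightarrow> 'e set \<Rightarrow> ('e \<Rightarrow> 'n::finite set) \<Rightarrow> (rat ^ 'n) set" where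
  "internal_points SS c E ends =
     {c + indeg_vec E h | h. orientation E ends h \<and> strong SS E ends h}"

lemma few_valuesI_internal:
  fixes ends :: "'e \<Rightarrow> 'n::finite set"
  assumes "\<And>S y. S \<in> SS \<Longrightarrow> S \<noteq> {} \<Longrightarrow> S \<noteq> UNIV \<Longrightarrow> y \<in> Y \<Longrightarrow>
      \<exists>k::int. (\<Sum>i\<in>S. y $ i) = C S + of_int k \<and> 0 < k \<and> k < int (card (boundary E ends S))"
    and "\<And>y. y \<in> Y \<Longrightarrow> (\<Sum>i\<in>UNIV. y $ i) = t"
  shows "few_values SS (internal_exponent E ends) Y"
  unfolding few_values_def
proof
  fix S assume S: "S \<in> SS"
  consider "S = {}" | "S = UNIV" | "S \<noteq> {}" "S \<noteq> UNIV" by blast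
  then show "\<exists>A. finite A \<and> card A \<le> internal_exponent E ends S \<and> (\<forall>y\<in>Y. (\<Sum>i\<in>S. y $ i) \<in> A)"
  proof cases
    case 1
    then show ?thesis by (intro exI[of _ "{0}"]) (simp add: internal_exponent_def)
  next
    case 2
    with assms(2) show ?thesis by (intro exI[of _ "{t}"]) (auto simp: internal_exponent_def)
  next
    case 3
    let ?B = "{0<..<int (card (boundary E ends S))}"
    let ?A = "(\<lambda>k. C S + of_int k) ` ?B"
    have "card ?A \<le> card ?B" by (rule card_image_le) simp
    then have "card ?A \<le> internal_exponent E ends S"
      using 3 by (simp add: internal_exponent_def nat_diff_distrib)
    moreover have "(\<Sum>i\<in>S. y $ i) \<in> ?A" if "y \<in> Y" for y
      using assms(1)[OF S 3 that] by auto
    ultimately show ?thesis by (intro exI[of _ ?A]) auto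
  qed
qed

lemma few_values_internal:
  fixes ends :: "'e \<Rightarrow> 'n::finite set"
  assumes E: "finite E" "\<And>e. e \<in> E \<Longrightarrow> card (ends e) = 2"
    and SS: "\<And>S. S \<in> SS \<Longrightarrow> - S \<in> SS"
  shows "few_values SS (internal_exponent E ends) (internal_points SS c E ends)"
proof (rule few_valuesI_internal[where t = "(\<Sum>i\<in>UNIV. c $ i) + of_nat (card E)"
      and C = "\<lambda>S. (\<Sum>i\<in>S. c $ i) + of_nat (card {e \<in> E. ends e \<subseteq> S})"])
  fix y assume "y \<in> internal_points SS c E ends"
  then obtain h where h: "y = c + indeg_vec E h" "orientation E ends h" "strong SS E ends h"
    by (auto simp: internal_points_def)
  show "(\<Sum>i\<in>UNIV. y $ i) = (\<Sum>i\<in>UNIV. c $ i) + of_nat (card E)"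
    by (simp add: h(1) sum.distrib sum_indeg_vec[OF E(1)])
  fix S assume S: "S \<in> SS" "S \<noteq> {}" "S \<noteq> UNIV"
  let ?B = "boundary E ends S"
  have entering: "\<exists>e\<in>boundary E ends T. h e \<in> T" if T: "T \<in> SS" "T \<noteq> {}" "T \<noteq> UNIV" for T
  proof -
    obtain e where e: "e \<in> E" "h e \<in> T" "\<not> ends e \<subseteq> T"
      using h(3) T unfolding strong_def by blast
    then obtain a b where "ends e = {a, b}" using E(2) by (meson card_2_iff)
    with e h(2) show ?thesis by (intro bexI[of _ e]) (auto simp: boundary_iff orientation_def)
  qed
  obtain e1 where e1: "e1 \<in> ?B" "h e1 \<in> S" using entering[OF S] by blast
  obtain e2 where e2: "e2 \<in> ?B" "h e2 \<notin> S"
    using entering[OF SS[OF S(1)]] S by (auto simp: boundary_Compl)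
  have fin: "finite ?B" by (rule finite_boundary[OF E(1)])
  have "0 < card {e \<in> ?B. h e \<in> S}" using e1 fin by (auto simp: card_gt_0_iff)
  moreover have "card {e \<in> ?B. h e \<in> S} < card ?B" using e2 fin by (intro psubset_card_mono) auto
  moreover have "(\<Sum>i\<in>S. y $ i) = (\<Sum>i\<in>S. c $ i) + of_nat (card {e \<in> E. ends e \<subseteq> S})
      + of_nat (card {e \<in> ?B. h e \<in> S})"
    by (simp add: h(1) sum.distrib sum_indeg_vec[OF E(1)] card_heads_in[OF E h(2)])
  ultimately show "\<exists>k::int. (\<Sum>i\<in>S. y $ i) = (\<Sum>i\<in>S. c $ i)
      + of_nat (card {e \<in> E. ends e \<subseteq> S}) + of_int k \<and> 0 < k \<and> k < int (card ?B)"
    by (intro exI[of _ "int (card {e \<in> ?B. h e \<in> S})"]) simp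
qed

lemma strong_insert:
  "strong SS E ends h \<Longrightarrow> e \<notin> E \<Longrightarrow> strong SS (insert e E) ends (h(e := u))"
  unfolding strong_def by (metis fun_upd_other insertI2)

text \<open>
  If neither orientation of the edge works, a set \<open>S\<close> with \<open>b \<in> S\<close>, \<open>a \<notin> S\<close> and a set \<open>T\<close> with
  \<open>a \<in> T\<close>, \<open>b \<notin> T\<close> are both entered by no other edge, hence neither are \<open>S \<inter> T\<close> and \<open>S \<union> T\<close>.
  These do not separate \<open>a\<close> from \<open>b\<close>, so that strong connectivity of the contraction leaves only
  \<open>T = - S\<close>, and the edge is a bridge.
\<close>

lemma strong_lift:
  fixes ends :: "'e \<Rightarrow> 'n::finite set"
  assumes h: "orientation E ends h" "strong (unions_of_classes (insert (a, b) K)) E ends h"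
    and e: "e \<notin> E" "ends e = {a, b}"
    and no_bridge: "\<And>S. S \<in> unions_of_classes K \<Longrightarrow> S \<noteq> {} \<Longrightarrow> S \<noteq> UNIV \<Longrightarrow> boundary E ends S \<noteq> {}"
  shows "\<exists>u\<in>{a, b}. strong (unions_of_classes K) (insert e E) ends (h(e := u))"
proof (rule ccontr)
  assume neg: "\<not> ?thesis"
  let ?SS = "unions_of_classes K"
  define entered where "entered S \<longleftrightarrow> (\<exists>x\<in>E. h x \<in> S \<and> \<not> ends x \<subseteq> S)" for S
  have contracted: "entered S" if "S \<in> ?SS" "a \<in> S \<longleftrightarrow> b \<in> S" "S \<noteq> {}" "S \<noteq> UNIV" for S
    using h(2) that by (auto simp: strong_def unions_of_classes_insert entered_def)
  have obstruction: "\<exists>S\<in>?SS. w \<in> S \<and> u \<notin> S \<and> \<not> entered S" if u: "{u, w} = {a, b}" for u w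
  proof -
    from u have "u \<in> {a, b}" by blast
    with neg have "\<not> strong ?SS (insert e E) ends (h(e := u))" by blast
    then obtain S where S: "S \<in> ?SS" "S \<noteq> {}" "S \<noteq> UNIV"
      "\<And>x. x \<in> insert e E \<Longrightarrow> (h(e := u)) x \<in> S \<Longrightarrow> ends x \<subseteq> S"
      unfolding strong_def by blast
    have "\<not> entered S" using S(4) e(1) unfolding entered_def by (metis fun_upd_other insertI2)
    moreover have "u \<notin> S \<or> w \<in> S" using S(4)[of e] e(2) u by auto
    moreover have "\<not> (u \<in> S \<longleftrightarrow> w \<in> S)"
      using contracted[of S] S(1-3) \<open>\<not> entered S\<close> u by (auto simp: doubleton_eq_iff)
    ultimately show ?thesis using S(1) by blast
  qed
  obtain S where S: "S \<in> ?SS" "b \<in> S" "a \<notin> S" "\<not> entered S"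
    using obstruction[of a b] by blast
  obtain T where T: "T \<in> ?SS" "a \<in> T" "b \<notin> T" "\<not> entered T"
    using obstruction[of b a] by (auto simp: insert_commute)
  have "S \<inter> T \<in> ?SS" "S \<union> T \<in> ?SS" using S(1) T(1) by (auto simp: unions_of_classes_def)
  moreover have "\<not> entered (S \<inter> T)" "\<not> entered (S \<union> T)"
    using S(4) T(4) unfolding entered_def by blast+
  ultimately have "S \<inter> T = {}" "S \<union> T = UNIV"
    using contracted[of "S \<inter> T"] contracted[of "S \<union> T"] S T by blast+
  then have T_eq: "T = - S" by blast
  obtain x where x: "x \<in> boundary E ends S"
    using no_bridge[OF S(1)] S(2,3) by blast
  then obtain p q where pq: "x \<in> E" "ends x = {p, q}" "p \<in> S" "q \<notin> S"
    by (auto simp: boundary_def)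
  then have "h x \<in> {p, q}" using h(1) by (auto simp: orientation_def)
  with pq S(4) T(4) show False unfolding entered_def T_eq by auto
qed

lemma unions_of_classes_Compl: "S \<in> unions_of_classes K \<Longrightarrow> - S \<in> unions_of_classes K"
  by (auto simp: unions_of_classes_def)

lemma internal_points_insert:
  assumes "finite E" "e \<notin> E" "u \<in> ends e" "orientation E ends h"
    "strong SS (insert e E) ends (h(e := u))"
  shows "c + axis u 1 + indeg_vec E h \<in> internal_points SS c (insert e E) ends"
proof -
  have "c + axis u 1 + indeg_vec E h = c + indeg_vec (insert e E) (h(e := u))"
    using assms by (simp add: indeg_vec_insert indeg_vec_upd add.assoc)
  moreover have "orientation (insert e E) ends (h(e := u))"
    using assms by (auto simp: orientation_def)
  ultimately show ?thesis unfolding internal_points_def using assms(5) by blast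
qed

text \<open>
  A cut that consists of the edge alone has exponent \<open>0\<close>, and the ideal is the whole ring. Without
  such a cut, deleting the edge leaves the minor connected, which keeps the internal exponents from being truncated.
\<close>

lemma internal_harmonic:
  fixes ends :: "'e \<Rightarrow> 'n::finite set"
  assumes "finite E" "\<And>e. e \<in> E \<Longrightarrow> card (ends e) = 2"
    and "\<And>S. S \<in> unions_of_classes K \<Longrightarrow> S \<noteq> {} \<Longrightarrow> S \<noteq> UNIV \<Longrightarrow> boundary E ends S \<noteq> {}"
  shows "harmonic (edge_vectors K) (unions_of_classes K) (internal_exponent E ends)
    (internal_points (unions_of_classes K) c E ends)"
  using assms
proof (induction E arbitrary: K c rule: finite_induct)
  case empty
  then have trivial: "S = {} \<or> S = UNIV" if "S \<in> unions_of_classes K" for S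
    using that by auto
  show ?case
  proof (rule harmonic_base[where y = "c + indeg_vec {} (undefined :: 'e \<Rightarrow> 'n)"])
    show "internal_exponent {} ends S = 1" if "S \<in> unions_of_classes K" for S
      using trivial[OF that] by (simp add: internal_exponent_def)
    show "c + indeg_vec {} (undefined :: 'e \<Rightarrow> 'n) \<in> internal_points (unions_of_classes K) c {} ends"
      using trivial by (auto simp: internal_points_def orientation_def strong_def intro!: exI[of _ undefined])
  qed
next
  case (insert e E)
  obtain a b where ab: "ends e = {a, b}" "a \<noteq> b"
    using insert.prems(1)[of e] by (auto simp: card_2_iff)
  let ?SS = "unions_of_classes K"
  have boundary: "boundary (insert e E) ends S =
      (if a \<in> S \<longleftrightarrow> b \<in> S then boundary E ends S else insert e (boundary E ends S))" for S
    using insert.hyps by (simp add: boundary_insert[where ends = ends and e = e, OF ab(1)])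
  have e_notin: "e \<notin> boundary E ends S" for S using insert.hyps by (auto simp: boundary_def)
  have fin: "finite (boundary E ends S)" for S by (rule finite_boundary[OF insert.hyps(1)])
  have IH: "harmonic (edge_vectors K) (unions_of_classes K) (internal_exponent E ends)
      (internal_points (unions_of_classes K) c E ends)"
    if "\<And>S. S \<in> unions_of_classes K \<Longrightarrow> S \<noteq> {} \<Longrightarrow> S \<noteq> UNIV \<Longrightarrow> boundary E ends S \<noteq> {}" for K c
    using insert.IH insert.prems(1) that by auto
  have Y: "y \<in> internal_points ?SS c (insert e E) ends"
    if y: "y \<in> internal_points ?SS (c + axis u 1) E ends" and u: "u \<in> {a, b}" for y u
  proof -
    obtain h where h: "y = c + axis u 1 + indeg_vec E h" "orientation E ends h" "strong ?SS E ends h"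
      using y by (auto simp: internal_points_def)
    show ?thesis unfolding h(1)
      using u ab insert.hyps h(2) strong_insert[OF h(3), of e u]
      by (intro internal_points_insert) auto
  qed
  consider (loop) "\<forall>S\<in>?SS. a \<in> S \<longleftrightarrow> b \<in> S"
    | (bridge) S where "S \<in> ?SS" "S \<noteq> {}" "S \<noteq> UNIV" "boundary E ends S = {}" "\<not> (a \<in> S \<longleftrightarrow> b \<in> S)"
    | (cyclic) S0 where "S0 \<in> ?SS" "\<not> (a \<in> S0 \<longleftrightarrow> b \<in> S0)"
      "\<And>S. S \<in> ?SS \<Longrightarrow> S \<noteq> {} \<Longrightarrow> S \<noteq> UNIV \<Longrightarrow> boundary E ends S \<noteq> {}"
    using insert.prems(2) boundary by metis
  then show ?case
  proof cases
    case loop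
    have "harmonic (edge_vectors K) ?SS (internal_exponent E ends)
        (internal_points ?SS (c + axis a 1) E ends)"
      using insert.prems(2) boundary loop by (intro IH) metis
    then show ?thesis
      by (rule harmonic_transfer) (use loop Y in \<open>auto simp: internal_exponent_def boundary\<close>)
  next
    case bridge
    then have "internal_exponent (insert e E) ends S = 0"
      by (simp add: internal_exponent_def boundary)
    with bridge(1) show ?thesis by (rule harmonic_of_unit_generator)
  next
    case cyclic
    let ?v = "axis a 1 - axis b 1 :: rat ^ 'n"
    (* The cut stays nonempty without e, so the truncated subtraction commutes with Suc. *)
    have exponent: "internal_exponent (insert e E) ends S =
        (if a \<in> S \<longleftrightarrow> b \<in> S then internal_exponent E ends S else Suc (internal_exponent E ends S))"
      if "S \<in> ?SS" for S
    proof (cases "a \<in> S \<longleftrightarrow> b \<in> S")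
      case False
      then have "S \<noteq> {}" "S \<noteq> UNIV" by auto
      moreover from this have "card (boundary E ends S) > 0"
        using cyclic(3)[OF that] fin by (simp add: card_gt_0_iff)
      ultimately show ?thesis
        using False e_notin fin by (simp add: internal_exponent_def boundary)
    qed (simp add: internal_exponent_def boundary)
    show ?thesis
    proof (rule deletion_contraction[where v = ?v and p' = "internal_exponent E ends"
          and Y' = "internal_points ?SS (c + axis b 1) E ends"])
      show "var_sum S \<in> inv_ring (edge_vectors K)" if "S \<in> ?SS" for S
        using that by (rule var_sum_in_inv_ring)
      show "S0 \<in> ?SS" "deriv_along ?v (var_sum S0) \<noteq> 0"
        using cyclic by (simp_all add: deriv_edge_var_sum_zero)
      show "internal_exponent (insert e E) ends S = (if deriv_along ?v (var_sum S) = 0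
          then internal_exponent E ends S else Suc (internal_exponent E ends S))" if "S \<in> ?SS" for S
        unfolding deriv_edge_var_sum_zero by (rule exponent[OF that])
      show "few_values ?SS (internal_exponent (insert e E) ends)
          (internal_points ?SS c (insert e E) ends)"
        using insert by (intro few_values_internal unions_of_classes_Compl) auto
      show "y \<in> internal_points ?SS c (insert e E) ends \<and> y + ?v \<in> internal_points ?SS c (insert e E) ends"
        if "y \<in> internal_points ?SS (c + axis b 1) E ends" for y
      proof
        show "y \<in> internal_points ?SS c (insert e E) ends" using Y[OF that] by simp
        have "y + ?v \<in> internal_points ?SS (c + axis a 1) E ends"
          using that by (auto simp: internal_points_def algebra_simps)
        then show "y + ?v \<in> internal_points ?SS c (insert e E) ends" using Y by simp
      qed
      show "harmonic (edge_vectors K) ?SS (internal_exponent E ends)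
          (internal_points ?SS (c + axis b 1) E ends)"
        by (rule IH[OF cyclic(3)])
      let ?K = "insert (a, b) K"
      have "harmonic (edge_vectors ?K) (unions_of_classes ?K) (internal_exponent E ends)
          (internal_points (unions_of_classes ?K) (c + axis a 1) E ends)"
        using cyclic(3) by (intro IH) (auto simp: unions_of_classes_insert)
      then have "harmonic (edge_vectors ?K) (unions_of_classes ?K) (internal_exponent (insert e E) ends)
          (internal_points ?SS c (insert e E) ends)"
      proof (rule harmonic_transfer)
        show "internal_exponent E ends S = internal_exponent (insert e E) ends S"
          if "S \<in> unions_of_classes ?K" for S
          using that exponent by (auto simp: unions_of_classes_insert)
        fix y assume "y \<in> internal_points (unions_of_classes ?K) (c + axis a 1) E ends"
        then obtain h where h: "y = c + axis a 1 + indeg_vec E h" "orientation E ends h"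
          "strong (unions_of_classes ?K) E ends h"
          by (auto simp: internal_points_def)
        obtain u where u: "u \<in> {a, b}" "strong ?SS (insert e E) ends (h(e := u))"
          using strong_lift[OF h(2,3) insert.hyps(2) ab(1) cyclic(3)] by blast
        have "c + axis u 1 + indeg_vec E h \<in> internal_points ?SS c (insert e E) ends"
          using insert.hyps ab u h(2) by (intro internal_points_insert) auto
        moreover have "y - ?v = c + axis b 1 + indeg_vec E h" by (simp add: h(1))
        ultimately have "y \<in> internal_points ?SS c (insert e E) ends \<or>
            y - ?v \<in> internal_points ?SS c (insert e E) ends"
          using u(1) h(1) by (metis empty_iff insert_iff)
        then show "y \<in> internal_points ?SS c (insert e E) ends \<or>
            (\<exists>v\<in>edge_vectors ?K. y - v \<in> internal_points ?SS c (insert e E) ends)"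
          by (auto simp: edge_vectors_insert)
      qed
      then show "harmonic (insert ?v (edge_vectors K))
          {S \<in> ?SS. deriv_along ?v (var_sum S) = 0}
          (internal_exponent (insert e E) ends) (internal_points ?SS c (insert e E) ends)"
        by (simp add: unions_of_classes_insert edge_vectors_insert deriv_edge_var_sum_zero)
    qed
  qed
qed

section \<open>Interior lattice points of the graphical zonotope\<close>

lemma convex_zonotope: "convex (zonotope E ends)"
  unfolding zonotope_def by (intro convex_set_sum convex_convex_hull)

lemma zonotopeE:
  assumes "finite E" "x \<in> zonotope E ends"
  obtains s where "x = (\<Sum>e\<in>E. s e)" "\<And>e. e \<in> E \<Longrightarrow> s e \<in> convex hull ((\<lambda>i. axis i 1) ` ends e)"
  using assms by (auto simp: zonotope_def set_sum_alt)

lemma orientation_in_zonotope: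
  assumes "finite E" "orientation E ends h"
  shows "(\<Sum>e\<in>E. axis (h e) 1) \<in> zonotope E ends"
  using assms unfolding zonotope_def set_sum_alt[OF assms(1)]
  by (auto simp: orientation_def intro!: hull_inc)

lemma sum_axis_real: "(\<Sum>i\<in>S. (axis a 1 :: real ^ 'n::finite) $ i) = (if a \<in> S then 1 else 0)"
  by (simp add: axis_def)

lemma sum_coordinates_inner:
  fixes x :: "real ^ 'n::finite"
  shows "(\<Sum>i\<in>S. x $ i) = (\<chi> i. if i \<in> S then 1 else 0) \<bullet> x"
  by (simp add: inner_vec_def if_distrib[of "\<lambda>r. r * _"] sum.If_cases cong: if_cong)

lemma zonotope_sum_ge:
  fixes x :: "real ^ 'n::finite"
  assumes "finite E" "x \<in> zonotope E ends"
  shows "real (card {e \<in> E. ends e \<subseteq> S}) \<le> (\<Sum>i\<in>S. x $ i)"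
proof -
  obtain s where s: "x = (\<Sum>e\<in>E. s e)" "\<And>e. e \<in> E \<Longrightarrow> s e \<in> convex hull ((\<lambda>i. axis i 1) ` ends e)"
    using assms by (rule zonotopeE) (rule that)
  have ge: "(if ends e \<subseteq> S then 1 else 0) \<le> (\<Sum>i\<in>S. s e $ i)" if "e \<in> E" for e
  proof -
    let ?a = "(\<chi> i. if i \<in> S then 1 else 0) :: real ^ 'n"
    have "convex hull ((\<lambda>i. axis i 1) ` ends e) \<subseteq> {x. ?a \<bullet> x \<ge> (if ends e \<subseteq> S then 1 else 0)}"
      by (intro hull_minimal convex_halfspace_ge) (auto simp: sum_coordinates_inner[symmetric] sum_axis_real)
    from subsetD[OF this s(2)[OF that]] show ?thesis
      by (simp only: mem_Collect_eq sum_coordinates_inner)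
  qed
  have "real (card {e \<in> E. ends e \<subseteq> S}) = (\<Sum>e\<in>E. if ends e \<subseteq> S then 1 else 0)"
    using assms(1) by (simp add: sum.If_cases Int_def)
  also have "\<dots> \<le> (\<Sum>e\<in>E. \<Sum>i\<in>S. s e $ i)" by (intro sum_mono ge)
  also have "\<dots> = (\<Sum>i\<in>S. x $ i)" by (simp add: s(1) sum.swap[of _ S])
  finally show ?thesis .
qed

lemma zonotope_sum_UNIV:
  fixes x :: "real ^ 'n::finite"
  assumes "finite E" "x \<in> zonotope E ends"
  shows "(\<Sum>i\<in>UNIV. x $ i) = card E"
proof -
  obtain s where s: "x = (\<Sum>e\<in>E. s e)" "\<And>e. e \<in> E \<Longrightarrow> s e \<in> convex hull ((\<lambda>i. axis i 1) ` ends e)"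
    using assms by (rule zonotopeE) (rule that)
  have eq: "(\<Sum>i\<in>UNIV. s e $ i) = 1" if "e \<in> E" for e
  proof -
    let ?a = "(\<chi> i. if i \<in> UNIV then 1 else 0) :: real ^ 'n"
    have "convex hull ((\<lambda>i. axis i 1) ` ends e) \<subseteq> {x. ?a \<bullet> x = 1}"
      by (intro hull_minimal convex_hyperplane) (auto simp: sum_coordinates_inner[symmetric] sum_axis_real
        simp del: UNIV_I)
    from subsetD[OF this s(2)[OF that]] show ?thesis
      by (simp only: mem_Collect_eq sum_coordinates_inner)
  qed
  have "(\<Sum>i\<in>UNIV. x $ i) = (\<Sum>e\<in>E. \<Sum>i\<in>UNIV. s e $ i)" by (simp add: s(1) sum.swap[of _ UNIV])
  with eq show ?thesis by simp
qed

text \<open>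
  Directing all edges of the cut into \<open>S\<close> gives a point of the zonotope with larger \<open>S\<close>-sum than
  the lower bound. Prolonging the segment from there beyond a point of the relative interior stays
  in the zonotope, so the bound is strict at that point.
\<close>

lemma rel_interior_zonotope_sum_gt:
  fixes z :: "real ^ 'n::finite"
  assumes E: "finite E" "\<And>e. e \<in> E \<Longrightarrow> card (ends e) = 2"
    and z: "z \<in> rel_interior (zonotope E ends)" and S: "boundary E ends S \<noteq> {}"
  shows "real (card {e \<in> E. ends e \<subseteq> S}) < (\<Sum>i\<in>S. z $ i)"
proof -
  let ?Z = "zonotope E ends" and ?m = "real (card {e \<in> E. ends e \<subseteq> S})"
  define h where "h e = (SOME v. v \<in> ends e \<and> (ends e \<inter> S \<noteq> {} \<longrightarrow> v \<in> S))" for e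
  have h: "h e \<in> ends e \<and> (ends e \<inter> S \<noteq> {} \<longrightarrow> h e \<in> S)" if "e \<in> E" for e
  proof -
    have "ends e \<noteq> {}" using E(2)[OF that] by auto
    then have "\<exists>v. v \<in> ends e \<and> (ends e \<inter> S \<noteq> {} \<longrightarrow> v \<in> S)" by blast
    then show ?thesis unfolding h_def by (rule someI_ex)
  qed
  then have orient: "orientation E ends h" by (simp add: orientation_def)
  let ?x = "\<Sum>e\<in>E. axis (h e) 1 :: real ^ 'n"
  have x: "?x \<in> ?Z" by (rule orientation_in_zonotope[OF E(1) orient])
  have "(\<Sum>i\<in>S. ?x $ i) = (\<Sum>e\<in>E. \<Sum>i\<in>S. (axis (h e) 1 :: real ^ 'n) $ i)"
    by (simp add: sum.swap[of _ S])
  also have "\<dots> = real (card {e \<in> E. h e \<in> S})"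
    unfolding sum_axis_real using E(1) by (simp add: sum.If_cases Int_def)
  also have "{e \<in> boundary E ends S. h e \<in> S} = boundary E ends S"
    using h by (fastforce simp: boundary_def)
  then have "real (card {e \<in> E. h e \<in> S}) = ?m + card (boundary E ends S)"
    using card_heads_in[OF E orient, of S] by simp
  finally have sum_x: "(\<Sum>i\<in>S. ?x $ i) = ?m + card (boundary E ends S)" .
  obtain t where t: "t > 1" "(1 - t) *\<^sub>R ?x + t *\<^sub>R z \<in> ?Z"
    using z x convex_rel_interior_iff[OF convex_zonotope, of E ends z] by blast
  have "?m \<le> (\<Sum>i\<in>S. ((1 - t) *\<^sub>R ?x + t *\<^sub>R z) $ i)"
    by (rule zonotope_sum_ge[OF E(1) t(2)])
  also have "\<dots> = (1 - t) * (\<Sum>i\<in>S. ?x $ i) + t * (\<Sum>i\<in>S. z $ i)"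
    by (simp add: sum.distrib sum_distrib_left)
  finally have "?m \<le> (1 - t) * (?m + card (boundary E ends S)) + t * (\<Sum>i\<in>S. z $ i)"
    by (simp only: sum_x)
  then have "t * ?m + (t - 1) * card (boundary E ends S) \<le> t * (\<Sum>i\<in>S. z $ i)"
    by (simp add: algebra_simps)
  moreover have "(t - 1) * card (boundary E ends S) > 0"
    using t(1) S finite_boundary[OF E(1), of ends S] by (simp add: card_gt_0_iff)
  ultimately have "t * ?m < t * (\<Sum>i\<in>S. z $ i)" by linarith
  then show ?thesis using t(1) by simp
qed

lemma card_edges_split:
  fixes ends :: "'e \<Rightarrow> 'n::finite set"
  assumes "finite E" "\<And>e. e \<in> E \<Longrightarrow> card (ends e) = 2"
  shows "card E = card {e \<in> E. ends e \<subseteq> S} + card {e \<in> E. ends e \<subseteq> - S} + card (boundary E ends S)"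
proof -
  have "ends e \<noteq> {}" if "e \<in> E" for e using assms(2)[OF that] by auto
  have "e \<in> E \<longleftrightarrow> e \<in> {e \<in> E. ends e \<subseteq> S} \<union> {e \<in> E. ends e \<subseteq> - S} \<union> boundary E ends S" for e
  proof (cases "e \<in> E")
    case True
    then obtain a b where "ends e = {a, b}" using assms(2) by (meson card_2_iff)
    with True show ?thesis by (auto simp: boundary_iff)
  qed (auto simp: boundary_def)
  then have E: "E = {e \<in> E. ends e \<subseteq> S} \<union> {e \<in> E. ends e \<subseteq> - S} \<union> boundary E ends S" by blast
  have "card E = card ({e \<in> E. ends e \<subseteq> S} \<union> {e \<in> E. ends e \<subseteq> - S}) + card (boundary E ends S)"
    using assms(1) by (subst E, intro card_Un_disjoint) (auto simp: finite_boundary boundary_def)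
  also have "card ({e \<in> E. ends e \<subseteq> S} \<union> {e \<in> E. ends e \<subseteq> - S}) =
      card {e \<in> E. ends e \<subseteq> S} + card {e \<in> E. ends e \<subseteq> - S}"
    using assms(1) \<open>\<And>e. e \<in> E \<Longrightarrow> ends e \<noteq> {}\<close> by (intro card_Un_disjoint) fastforce+
  finally show ?thesis .
qed

lemma rel_interior_shift:
  fixes a :: "'a::euclidean_space"
  shows "rel_interior ((\<lambda>x. x - a) ` S) = (\<lambda>x. x - a) ` rel_interior S"
proof -
  have "(\<lambda>x. x - a) = (\<lambda>x. - a + x)" by auto
  then show ?thesis by (simp only: rel_interior_translation)
qed

lemma orientable_interiorD:
  assumes "z \<in> orientable_interior E ends"
  shows "(\<chi> i. of_int (z $ i) + 1) \<in> rel_interior (zonotope E ends)"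
proof -
  obtain x where x: "x \<in> rel_interior (zonotope E ends)" "of_int_vec z = x - (\<chi> i. 1)"
    using assms unfolding orientable_interior_def by (auto simp: rel_interior_shift)
  then have "x = (\<chi> i. of_int (z $ i) + 1)" by (auto simp: of_int_vec_def vec_eq_iff)
  with x show ?thesis by simp
qed

text \<open>
  The strict lower bound for \<open>- S\<close> is a strict upper bound for \<open>S\<close>, since the sum of all coordinates
  is constant on the zonotope. The remaining integers are \<open>d(S) - 1\<close> in number.
\<close>

lemma few_values_orientable_interior:
  fixes ends :: "'e \<Rightarrow> 'n::finite set"
  assumes E: "finite E" "\<And>e. e \<in> E \<Longrightarrow> card (ends e) = 2"
    and conn: "\<And>S. S \<noteq> {} \<Longrightarrow> S \<noteq> UNIV \<Longrightarrow> boundary E ends S \<noteq> {}"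
  shows "few_values UNIV (internal_exponent E ends) (of_int_vec ` orientable_interior E ends)"
proof (rule few_valuesI_internal[where t = "of_nat (card E) - of_nat (CARD('n))"
      and C = "\<lambda>S. of_nat (card {e \<in> E. ends e \<subseteq> S}) - of_nat (card S)"])
  fix y :: "rat ^ 'n" assume "y \<in> of_int_vec ` orientable_interior E ends"
  then obtain z where z: "z \<in> orientable_interior E ends" "y = of_int_vec z" by blast
  let ?x = "(\<chi> i. of_int (z $ i) + 1) :: real ^ 'n"
  have x: "?x \<in> rel_interior (zonotope E ends)" by (rule orientable_interiorD[OF z(1)])
  have y_sum: "(\<Sum>i\<in>S. y $ i) = of_int (\<Sum>i\<in>S. z $ i)" for S
    by (simp add: z(2) of_int_vec_def)
  have x_sum: "(\<Sum>i\<in>S. ?x $ i) = of_int ((\<Sum>i\<in>S. z $ i) + int (card S))" for S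
    by (simp add: sum.distrib)
  have total: "(\<Sum>i\<in>UNIV. z $ i) + int CARD('n) = int (card E)"
  proof -
    have "?x \<in> zonotope E ends" using x rel_interior_subset by blast
    from zonotope_sum_UNIV[OF E(1) this]
    have "real_of_int ((\<Sum>i\<in>UNIV. z $ i) + int CARD('n)) = real_of_int (int (card E))"
      unfolding x_sum of_int_of_nat_eq .
    then show ?thesis by (simp only: of_int_eq_iff)
  qed
  from arg_cong[OF this, of rat_of_int]
  show "(\<Sum>i\<in>UNIV. y $ i) = of_nat (card E) - of_nat (CARD('n))"
    unfolding y_sum by (simp only: of_int_add of_int_of_nat_eq eq_diff_eq)
  fix S :: "'n set" assume S: "S \<noteq> {}" "S \<noteq> UNIV"
  have lower: "int (card {e \<in> E. ends e \<subseteq> T}) < (\<Sum>i\<in>T. z $ i) + int (card T)"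
    if "T \<noteq> {}" "T \<noteq> UNIV" for T
  proof -
    have "real_of_int (int (card {e \<in> E. ends e \<subseteq> T})) < real_of_int ((\<Sum>i\<in>T. z $ i) + int (card T))"
      using rel_interior_zonotope_sum_gt[OF E x conn[OF that]] unfolding x_sum of_int_of_nat_eq .
    then show ?thesis by (simp only: of_int_less_iff)
  qed
  have compl: "- S \<noteq> {}" "- S \<noteq> UNIV" using S by auto
  have "(\<Sum>i\<in>S. z $ i) + (\<Sum>i\<in>- S. z $ i) = (\<Sum>i\<in>UNIV. z $ i)"
    using sum.union_disjoint[of S "- S" "($) z"] by simp
  moreover have "card S + card (- S) = CARD('n)"
    using card_Un_disjoint[of S "- S"] by simp
  ultimately have "(\<Sum>i\<in>S. z $ i) + int (card S) - int (card {e \<in> E. ends e \<subseteq> S}) < int (card (boundary E ends S))"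
    using lower[OF compl] total card_edges_split[where ends = ends and S = S, OF E] by linarith
  moreover have "0 < (\<Sum>i\<in>S. z $ i) + int (card S) - int (card {e \<in> E. ends e \<subseteq> S})"
    using lower[OF S] by simp
  ultimately show "\<exists>k::int. (\<Sum>i\<in>S. y $ i) = of_nat (card {e \<in> E. ends e \<subseteq> S}) - of_nat (card S) + of_int k
      \<and> 0 < k \<and> k < int (card (boundary E ends S))"
    by (intro exI[of _ "(\<Sum>i\<in>S. z $ i) + int (card S) - int (card {e \<in> E. ends e \<subseteq> S})"])
      (simp add: y_sum)
qed

text \<open>
  A supporting hyperplane at the indegree vector has a normal \<open>a\<close> that does not increase from the
  tail to the head of any edge, because the edge can be reversed. Strong connectivity, applied to the set of
  vertices where \<open>a\<close> is largest, makes \<open>a\<close> constant, and then \<open>a\<close> is constant on the zonotope.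
\<close>

lemma strong_in_rel_interior:
  fixes ends :: "'e \<Rightarrow> 'n::finite set"
  assumes E: "finite E" and h: "orientation E ends h" "strong UNIV E ends h"
  shows "(\<Sum>e\<in>E. axis (h e) 1) \<in> rel_interior (zonotope E ends)"
proof (rule ccontr)
  let ?Z = "zonotope E ends" and ?x = "\<Sum>e\<in>E. axis (h e) 1 :: real ^ 'n"
  assume "?x \<notin> rel_interior ?Z"
  with convex_zonotope orientation_in_zonotope[OF E h(1)] obtain a
    where a: "\<And>y. y \<in> ?Z \<Longrightarrow> a \<bullet> ?x \<le> a \<bullet> y" "\<And>y. y \<in> rel_interior ?Z \<Longrightarrow> a \<bullet> ?x < a \<bullet> y"
    by (rule supporting_hyperplane_rel_boundary) blast
  have flip: "a $ h e \<le> a $ w" if "e \<in> E" "w \<in> ends e" for e w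
  proof -
    have "orientation E ends (h(e := w))" using h(1) that by (simp add: orientation_def)
    from a(1)[OF orientation_in_zonotope[OF E this]]
    have "a \<bullet> ?x \<le> a \<bullet> (\<Sum>x\<in>E. axis ((h(e := w)) x) 1)" .
    also have "(\<Sum>x\<in>E. axis ((h(e := w)) x) 1 :: real ^ 'n) = axis w 1 + (\<Sum>x\<in>E - {e}. axis (h x) 1)"
      using E that(1) by (simp add: sum.remove[of E e])
    also have "?x = axis (h e) 1 + (\<Sum>x\<in>E - {e}. axis (h x) 1)"
      using E that(1) by (simp add: sum.remove[of E e])
    finally show ?thesis by (simp add: inner_add_right inner_axis)
  qed
  define M where "M = Max (range (($) a))"
  have "\<exists>i. a $ i = M"
    using Max_in[of "range (($) a)"] unfolding M_def by fastforce
  have le_M: "a $ i \<le> M" for i by (simp add: M_def)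
  have "{i. a $ i = M} = UNIV"
  proof (rule ccontr)
    assume "{i. a $ i = M} \<noteq> UNIV"
    then have "\<exists>e\<in>E. h e \<in> {i. a $ i = M} \<and> \<not> ends e \<subseteq> {i. a $ i = M}"
      using h(2)[unfolded strong_def, rule_format, of "{i. a $ i = M}"] \<open>\<exists>i. a $ i = M\<close> by auto
    then obtain e w where "e \<in> E" "a $ h e = M" "w \<in> ends e" "a $ w \<noteq> M" by auto
    with flip[of e w] le_M[of w] show False by simp
  qed
  then have "a = (\<chi> i. M)" by (auto simp: vec_eq_iff)
  then have "a \<bullet> y = M * (\<Sum>i\<in>UNIV. y $ i)" for y
    by (simp add: inner_vec_def sum_distrib_left)
  then have const: "a \<bullet> y = M * card E" if "y \<in> ?Z" for y
    using zonotope_sum_UNIV[OF E that] by simp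
  have "?Z \<noteq> {}" using orientation_in_zonotope[OF E h(1)] by blast
  then obtain y where "y \<in> rel_interior ?Z"
    using rel_interior_eq_empty[OF convex_zonotope] by blast
  with a(2)[of y] const[of y] const[OF orientation_in_zonotope[OF E h(1)]] rel_interior_subset
  show False by fastforce
qed

lemma sum_axis_heads:
  assumes "finite E"
  shows "(\<Sum>e\<in>E. axis (h e) 1 :: real ^ 'n::finite) = (\<chi> i. of_nat (indeg E h i))"
  using assms by (simp add: vec_eq_iff axis_def indeg_def sum.If_cases Int_def eq_commute)

lemma internal_points_subset:
  fixes ends :: "'e \<Rightarrow> 'n::finite set"
  assumes "finite E"
  shows "internal_points UNIV (\<chi> i. - 1) E ends \<subseteq> of_int_vec ` orientable_interior E ends"
proof
  fix y assume "y \<in> internal_points UNIV (\<chi> i. - 1) E ends"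
  then obtain h where h: "y = (\<chi> i. - 1) + indeg_vec E h" "orientation E ends h" "strong UNIV E ends h"
    by (auto simp: internal_points_def)
  define z :: "int ^ 'n" where "z = (\<chi> i. int (indeg E h i) - 1)"
  have eq: "of_int_vec z = (\<Sum>e\<in>E. axis (h e) 1 :: real ^ 'n) - (\<chi> i. 1)"
    unfolding sum_axis_heads[OF assms] by (simp add: z_def of_int_vec_def vec_eq_iff)
  have "z \<in> orientable_interior E ends"
    using strong_in_rel_interior[OF assms h(2,3)] by (simp add: orientable_interior_def eq rel_interior_shift)
  moreover have "y = of_int_vec z"
    by (simp add: h(1) z_def of_int_vec_def indeg_vec_def vec_eq_iff)
  ultimately show "y \<in> of_int_vec ` orientable_interior E ends" by blast
qed

lemma of_int_vec_orientable:
  fixes ends :: "'a \<Rightarrow> 'b::finite set"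
  shows "of_int_vec ` orientable E ends = external_points (\<chi> i. - 1) E ends"
proof -
  have "of_int_vec (\<chi> i. int (indeg E h i) - 1) = (\<chi> i. - 1) + indeg_vec E h" for h :: "'a \<Rightarrow> 'b"
    by (simp add: of_int_vec_def indeg_vec_def vec_eq_iff)
  then show ?thesis
    by (auto simp: orientable_def external_points_def image_iff) (metis (no_types, lifting))+
qed

section \<open>Cuts that are not bonds\<close>

lemma connected_boundary_nonempty:
  assumes "connected_graph E ends" "S \<noteq> {}" "S \<noteq> UNIV"
  shows "boundary E ends S \<noteq> {}"
proof -
  obtain u v where uv: "u \<in> S" "v \<notin> S" using assms by blast
  have "(u, v) \<in> {(a, b). \<exists>e\<in>E. ends e = {a, b}}\<^sup>*"
    using assms(1) by (simp add: connected_graph_def)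
  then have "v \<notin> S \<Longrightarrow> \<exists>e a b. e \<in> E \<and> ends e = {a, b} \<and> a \<in> S \<and> b \<notin> S"
  proof (induction rule: rtrancl_induct)
    case base
    then show ?case using uv by simp
  next
    case (step v w)
    then show ?case by (cases "v \<in> S") blast+
  qed
  with uv show ?thesis by (auto simp: boundary_def)
qed

text \<open>
  A cut \<open>\<partial>(T)\<close> strictly inside \<open>\<partial>(S)\<close> has no edge within \<open>S\<close> and none within \<open>- S\<close>, so it cuts \<open>S\<close>
  or \<open>- S\<close> into two parts without edges between them.
\<close>

lemma non_bond_splits:
  fixes ends :: "'e \<Rightarrow> 'n::finite set"
  assumes S: "S \<noteq> {}" "S \<noteq> UNIV" "boundary E ends S \<noteq> {}" and nb: "\<not> bond E ends (boundary E ends S)"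
  obtains R S1 S2 where "R = S \<or> R = - S" "R = S1 \<union> S2" "S1 \<inter> S2 = {}" "S1 \<noteq> {}" "S2 \<noteq> {}"
    "boundary E ends S = boundary E ends S1 \<union> boundary E ends S2"
    "boundary E ends S1 \<inter> boundary E ends S2 = {}"
proof -
  have "edge_cut E ends (boundary E ends S)" using S by (auto simp: edge_cut_def)
  with nb S(3) obtain C where C: "edge_cut E ends C" "C \<subseteq> boundary E ends S" "C \<noteq> boundary E ends S" "C \<noteq> {}"
    unfolding bond_def by blast
  then obtain T where T: "T \<noteq> {}" "T \<noteq> UNIV" "C = boundary E ends T" by (auto simp: edge_cut_def)
  have "T \<noteq> S" "T \<noteq> - S" using C T by (auto simp: boundary_Compl)
  then obtain R where R: "R = S \<or> R = - S" "R \<inter> T \<noteq> {}" "R - T \<noteq> {}"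
    using T(1,2) by blast
  have R_boundary: "boundary E ends R = boundary E ends S" using R(1) by (auto simp: boundary_Compl)
  have no_edge: False if "e \<in> E" "ends e = {p, q}" "p \<in> R \<inter> T" "q \<in> R - T" for e p q
  proof -
    have "e \<in> boundary E ends T" using that by (auto simp: boundary_iff)
    with C(2) T(3) R_boundary have "e \<in> boundary E ends R" by blast
    with that show False by (auto simp: boundary_iff)
  qed
  show thesis
  proof (rule that[of R "R \<inter> T" "R - T"])
    show "boundary E ends (R \<inter> T) \<inter> boundary E ends (R - T) = {}"
    proof (rule ccontr)
      assume "boundary E ends (R \<inter> T) \<inter> boundary E ends (R - T) \<noteq> {}"
      then obtain e where e1: "e \<in> boundary E ends (R \<inter> T)" and e2: "e \<in> boundary E ends (R - T)"
        by blast
      from e1 obtain p q where e: "e \<in> E" "ends e = {p, q}" "p \<in> R \<inter> T"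
        by (auto simp: boundary_def)
      with e2 have "q \<in> R - T" by (auto simp: boundary_iff)
      with no_edge e show False by blast
    qed
    show "boundary E ends S = boundary E ends (R \<inter> T) \<union> boundary E ends (R - T)"
      unfolding R_boundary[symmetric]
    proof (intro equalityI subsetI)
      fix e assume "e \<in> boundary E ends R"
      then obtain p q where "e \<in> E" "ends e = {p, q}" "p \<in> R" "q \<notin> R" by (auto simp: boundary_def)
      then show "e \<in> boundary E ends (R \<inter> T) \<union> boundary E ends (R - T)" by (auto simp: boundary_iff)
    next
      fix e assume "e \<in> boundary E ends (R \<inter> T) \<union> boundary E ends (R - T)"
      then consider p q where "e \<in> E" "ends e = {p, q}" "p \<in> R \<inter> T" "q \<notin> R \<inter> T"
        | p q where "e \<in> E" "ends e = {p, q}" "p \<in> R - T" "q \<notin> R - T"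
        by (auto simp: boundary_def)
      then show "e \<in> boundary E ends R"
      proof cases
        case 1
        with no_edge[of e p q] show ?thesis by (auto simp: boundary_iff)
      next
        case 2
        with no_edge[of e q p] show ?thesis by (auto simp: boundary_iff insert_commute)
      qed
    qed
  qed (use R in auto)
qed

lemma ideal_power_mono:
  assumes "x ^ a \<in> ideal.span G" "a \<le> k"
  shows "x ^ k \<in> ideal.span G"
proof -
  have "x ^ k = x ^ (k - a) * x ^ a" using assms(2) by (simp add: power_add[symmetric])
  then show ?thesis using ideal.span_scale[OF assms(1)] by simp
qed

lemma ideal_power_add:
  assumes "x ^ a \<in> ideal.span G" "y ^ b \<in> ideal.span G" "a + b \<le> N + 1"
  shows "(x + y) ^ N \<in> ideal.span G"
  unfolding binomial_ring
proof (rule ideal.span_sum)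
  fix k
  show "of_nat (N choose k) * x ^ k * y ^ (N - k) \<in> ideal.span G"
  proof (cases "a \<le> k")
    case True
    from ideal.span_scale[OF ideal_power_mono[OF assms(1) True], of "of_nat (N choose k) * y ^ (N - k)"]
    show ?thesis by (simp add: mult_ac)
  next
    case False
    then have "b \<le> N - k" using assms(3) by simp
    from ideal.span_scale[OF ideal_power_mono[OF assms(2) this]] show ?thesis .
  qed
qed

text \<open>
  If \<open>S\<close> is the disjoint union of \<open>S\<^sub>1\<close> and \<open>S\<^sub>2\<close> without edges between them, then \<open>x\<^sub>S = x\<^bsub>S\<^sub>1\<^esub> + x\<^bsub>S\<^sub>2\<^esub>\<close> and
  the cut sizes add up, so that the binomial theorem produces the power for \<open>S\<close>. Modulo \<open>x\<^bsub>[n]\<^esub>\<close> the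
  linear forms of \<open>S\<close> and its complement differ by a sign. The function \<open>q\<close> stands for \<open>d + 1\<close> and
  for \<open>d - 1\<close>.
\<close>

lemma cut_powers_in_ideal:
  fixes ends :: "'e \<Rightarrow> 'n::finite set" and q :: "nat \<Rightarrow> nat"
  assumes E: "finite E" "connected_graph E ends"
    and G: "var_sum UNIV \<in> ideal.span G"
      "\<And>S. S \<noteq> {} \<Longrightarrow> S \<noteq> UNIV \<Longrightarrow> bond E ends (boundary E ends S) \<Longrightarrow>
        var_sum S ^ q (card (boundary E ends S)) \<in> ideal.span G"
    and q: "\<And>i j. 0 < i \<Longrightarrow> 0 < j \<Longrightarrow> q i + q j \<le> q (i + j) + 1"
    and S: "S \<noteq> {}" "S \<noteq> UNIV"
  shows "var_sum S ^ q (card (boundary E ends S)) \<in> ideal.span G"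
  using S
proof (induction "card (boundary E ends S)" arbitrary: S rule: less_induct)
  case less
  let ?d = "\<lambda>S. card (boundary E ends S)"
  have pos: "0 < ?d T" if "T \<noteq> {}" "T \<noteq> UNIV" for T
    using connected_boundary_nonempty[OF E(2) that] finite_boundary[OF E(1)] by (simp add: card_gt_0_iff)
  show ?case
  proof (cases "bond E ends (boundary E ends S)")
    case True
    with G(2) less.prems show ?thesis by blast
  next
    case False
    obtain R S1 S2 where R: "R = S \<or> R = - S" "R = S1 \<union> S2" "S1 \<inter> S2 = {}" "S1 \<noteq> {}" "S2 \<noteq> {}"
      "boundary E ends S = boundary E ends S1 \<union> boundary E ends S2"
      "boundary E ends S1 \<inter> boundary E ends S2 = {}"
      using non_bond_splits[OF less.prems connected_boundary_nonempty[OF E(2) less.prems] False] .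
    have proper: "S1 \<noteq> UNIV" "S2 \<noteq> UNIV" using R(3-5) by auto
    have d: "?d S = ?d S1 + ?d S2"
      unfolding R(6) by (intro card_Un_disjoint finite_boundary E(1) R(7))
    have "var_sum S1 ^ q (?d S1) \<in> ideal.span G" "var_sum S2 ^ q (?d S2) \<in> ideal.span G"
      using less.hyps R(4,5) proper pos d by auto
    then have "(var_sum S1 + var_sum S2) ^ q (?d S) \<in> ideal.span G"
      using q[OF pos pos, of S1 S2] R(4,5) proper d by (intro ideal_power_add) auto
    also have "var_sum S1 + var_sum S2 = var_sum R"
      using R(2,3) by (simp add: var_sum_def sum.union_disjoint)
    finally have R_power: "var_sum R ^ q (?d S) \<in> ideal.span G" .
    show ?thesis
    proof (cases "R = S")
      case True
      with R_power show ?thesis by simp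
    next
      case False
      with R(1) have "R = - S" by blast
      then have "(var_sum UNIV :: 'n mpoly) = var_sum S + var_sum R"
        unfolding var_sum_def by (subst sum.union_disjoint[symmetric]) auto
      then have eq: "var_sum S = var_sum UNIV + - var_sum R" by simp
      have "(- var_sum R) ^ q (?d S) \<in> ideal.span G"
        using ideal.span_scale[OF R_power, of "(- 1) ^ q (?d S)"]
        by (simp only: power_mult_distrib[symmetric] mult_minus_left mult_1_left)
      with G(1) show ?thesis
        unfolding eq by (intro ideal_power_add[where a = 1]) auto
    qed
  qed
qed

section \<open>Orbit harmonics and the two ideals\<close>

lemma total_degree_deg_le:
  assumes "f \<noteq> 0"
  shows "deg_le (total_degree f) f"
  by (simp add: deg_le_def total_degree_def)

lemma total_degree_eqI:
  assumes "deg_le d f" "hc d f \<noteq> 0"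
  shows "total_degree f = d"
proof -
  obtain m where "Poly_Mapping.lookup (hc d f) m \<noteq> 0"
    using assms(2) by (metis poly_mapping_eqI lookup_zero)
  then have "m \<in> Poly_Mapping.keys f" "mon_degree m = d"
    by (auto simp: lookup_hc in_keys_iff split: if_splits)
  with assms(1) show ?thesis
    unfolding total_degree_def deg_le_def by (intro Max_eqI) auto
qed

text \<open>
  The points enter the two inclusions differently: the leading forms are controlled by the vanishing
  on a subset \<open>Y0\<close>, and the generators are leading forms by the few values on all of \<open>Y\<close>. For the
  internal ideal \<open>Y0\<close> comes from strongly connected orientations and \<open>Y\<close> from the polytope.
\<close>

lemma top_ideal_eq_span:
  fixes Y :: "(rat ^ 'n::finite) set"
  assumes harm: "harmonic {} UNIV p Y0" "Y0 \<subseteq> Y" and few: "few_values UNIV p Y"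
    and G: "\<And>g. g \<in> G \<Longrightarrow> \<exists>S. g = var_sum S ^ p S"
    and all: "\<And>S. var_sum S ^ p S \<in> ideal.span G"
  shows "top_ideal Y = ideal.span G"
proof (rule antisym)
  show "top_ideal Y \<subseteq> ideal.span G"
    unfolding top_ideal_def
  proof (rule ideal.span_minimal)
    show "{top_component f |f. f \<in> vanishing_ideal Y \<and> f \<noteq> 0} \<subseteq> ideal.span G"
    proof clarify
      fix f assume f: "f \<in> vanishing_ideal Y" "f \<noteq> 0"
      have "hc (total_degree f) f \<in> power_ideal {} UNIV p"
        using f harm(2) by (intro harmonicD[OF harm(1)] total_degree_deg_le)
          (auto simp: inv_ring_def vanishing_ideal_def)
      then obtain r where "hc (total_degree f) f = (\<Sum>S\<in>UNIV. r S * var_sum S ^ p S)"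
        by (rule power_idealE)
      then show "top_component f \<in> ideal.span G"
        unfolding top_component_def by (simp only:) (intro ideal.span_sum ideal.span_scale all)
    qed
  qed (rule ideal.subspace_span)
  show "ideal.span G \<subseteq> top_ideal Y"
    unfolding top_ideal_def
  proof (rule ideal.span_minimal[OF _ ideal.subspace_span], rule subsetI)
    fix g assume "g \<in> G"
    then obtain S where g: "g = var_sum S ^ p S" using G by blast
    show "g \<in> ideal.span {top_component f |f. f \<in> vanishing_ideal Y \<and> f \<noteq> 0}"
    proof (cases "g = 0")
      case True
      then show ?thesis by (simp add: ideal.span_zero)
    next
      case False
      obtain A where "finite A" "card A \<le> p S" "\<And>y. y \<in> Y \<Longrightarrow> (\<Sum>i\<in>S. y $ i) \<in> A"
        using few unfolding few_values_def by blast
      then obtain w where w: "deg_le (p S) w" "hc (p S) w = g" "\<And>y. y \<in> Y \<Longrightarrow> eval y w = 0"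
        using vanishing_product[of A "p S" Y S "{}"] by (auto simp: g inv_ring_def)
      have "total_degree w = p S" using w False by (intro total_degree_eqI) auto
      then have "g = top_component w" by (simp add: top_component_def w(2))
      moreover have "w \<in> vanishing_ideal Y" "w \<noteq> 0"
        using w False by (auto simp: vanishing_ideal_def)
      ultimately show ?thesis by (intro ideal.span_base) blast
    qed
  qed
qed

lemma edge_vectors_empty: "edge_vectors {} = {}"
  and unions_of_classes_empty: "unions_of_classes {} = UNIV"
  by (simp_all add: edge_vectors_def unions_of_classes_def)

theorem proposition3p5:
  fixes E :: "'e set" and ends :: "'e \<Rightarrow> 'n::finite set"
  assumes "multigraph E ends" and "connected_graph E ends"
  shows "T_plus E ends = external_ideal E ends \<and>
    T_minus E ends = internal_ideal E ends"
proof
  have E: "finite E" "\<And>e. e \<in> E \<Longrightarrow> card (ends e) = 2"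
    using assms(1) by (auto simp: multigraph_def)
  have conn: "boundary E ends S \<noteq> {}" if "S \<noteq> {}" "S \<noteq> UNIV" for S
    using that by (rule connected_boundary_nonempty[OF assms(2)])
  have var_sum_empty: "var_sum {} = (0 :: 'n mpoly)" by (simp add: var_sum_def)
  show "T_plus E ends = external_ideal E ends"
    unfolding T_plus_def external_ideal_def of_int_vec_orientable
  proof (rule top_ideal_eq_span[where p = "external_exponent E ends"])
    show "harmonic {} UNIV (external_exponent E ends) (external_points (\<chi> i. - 1) E ends)"
      using external_harmonic[where K = "{}", OF E] by (simp add: edge_vectors_empty unions_of_classes_empty)
    show "few_values UNIV (external_exponent E ends) (external_points (\<chi> i. - 1) E ends)"
      by (rule few_values_external[OF E])
    let ?G = "insert (var_sum UNIV) {var_sum S ^ (card (boundary E ends S) + 1) |S.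
        S \<noteq> {} \<and> S \<noteq> UNIV \<and> bond E ends (boundary E ends S)}"
    show "\<exists>S. g = var_sum S ^ external_exponent E ends S" if "g \<in> ?G" for g
    proof (cases "g = var_sum UNIV")
      case True
      then show ?thesis by (intro exI[of _ UNIV]) (simp add: external_exponent_def)
    next
      case False
      with that obtain S where "g = var_sum S ^ (card (boundary E ends S) + 1)" "S \<noteq> {}" "S \<noteq> UNIV"
        by blast
      then show ?thesis by (intro exI[of _ S]) (simp add: external_exponent_def)
    qed
    show "var_sum S ^ external_exponent E ends S \<in> ideal.span ?G" for S
    proof -
      consider "S = {}" | "S = UNIV" | "S \<noteq> {}" "S \<noteq> UNIV" by blast
      then show ?thesis
      proof cases
        case 3
        have "var_sum S ^ (\<lambda>d. d + 1) (card (boundary E ends S)) \<in> ideal.span ?G"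
          by (rule cut_powers_in_ideal[OF E(1) assms(2) _ _ _ 3]) (auto intro!: ideal.span_base)
        then show ?thesis by (simp add: external_exponent_def)
      qed (auto simp: external_exponent_def var_sum_empty ideal.span_zero intro: ideal.span_base)
    qed
  qed simp
  show "T_minus E ends = internal_ideal E ends"
    unfolding T_minus_def internal_ideal_def
  proof (rule top_ideal_eq_span[where p = "internal_exponent E ends"])
    show "harmonic {} UNIV (internal_exponent E ends) (internal_points UNIV (\<chi> i. - 1) E ends)"
      using internal_harmonic[where K = "{}", OF E] conn by (simp add: edge_vectors_empty unions_of_classes_empty)
    show "internal_points UNIV (\<chi> i. - 1) E ends \<subseteq> of_int_vec ` orientable_interior E ends"
      by (rule internal_points_subset[OF E(1)])
    show "few_values UNIV (internal_exponent E ends) (of_int_vec ` orientable_interior E ends)"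
      by (rule few_values_orientable_interior[OF E conn])
    let ?G = "insert (var_sum UNIV) {var_sum S ^ (card (boundary E ends S) - 1) |S.
        S \<noteq> {} \<and> S \<noteq> UNIV \<and> bond E ends (boundary E ends S)}"
    show "\<exists>S. g = var_sum S ^ internal_exponent E ends S" if "g \<in> ?G" for g
    proof (cases "g = var_sum UNIV")
      case True
      then show ?thesis by (intro exI[of _ UNIV]) (simp add: internal_exponent_def)
    next
      case False
      with that obtain S where "g = var_sum S ^ (card (boundary E ends S) - 1)" "S \<noteq> {}" "S \<noteq> UNIV"
        by blast
      then show ?thesis by (intro exI[of _ S]) (simp add: internal_exponent_def)
    qed
    show "var_sum S ^ internal_exponent E ends S \<in> ideal.span ?G" for S
    proof -
      consider "S = {}" | "S = UNIV" | "S \<noteq> {}" "S \<noteq> UNIV" by blast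
      then show ?thesis
      proof cases
        case 3
        have "var_sum S ^ (\<lambda>d. d - 1) (card (boundary E ends S)) \<in> ideal.span ?G"
          by (rule cut_powers_in_ideal[OF E(1) assms(2) _ _ _ 3]) (auto intro!: ideal.span_base)
        then show ?thesis using 3 by (simp add: internal_exponent_def)
      qed (auto simp: internal_exponent_def var_sum_empty ideal.span_zero intro: ideal.span_base)
    qed
  qed
qed

end
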